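(* Let $X$ be a compact metric space, $f:X\to X$ a continuous map, $\varphi:X\to\mathbb{R}$ a continuous function, and $\mu\in\mathcal{M}(X,f)$ an $f$-invariant Borel probability measure. Then $$P_\mu(f,\varphi)=\operatorname{ess\,sup}\{h_\mu(x)+\varphi^*(x):x\in X\},$$ where the essential supremum is taken with respect to $\mu$. If, in addition, $\mu$ is ergodic, then $$P_\mu(f,\varphi,x)=P_\mu(f,\varphi)=h_\mu(f)+\int_X\varphi\,d\mu$$ for $\mu$-almost every $x\in X$.
   Context: Let $d$ be the metric on $X$; $\mathcal{M}(X,f)$ is the set of $f$-invariant Borel probability measures on $X$; $h_\mu(f)$ is the Kolmogorov–Sinai entropy. Put $S_n\varphi(x)=\sum_{i=0}^{n-1}\varphi(f^ix)$, $d_n(x,y)=\max\{d(f^ix,f^iy):0\le i<n\}$ and $B_n(x,\epsilon)=\{y\in X:d_n(x,y)<\epsilon\}$. Local entropy and Birkhoff average (defined for $\mu$-a.e. $x$, by the Brin–Katok and Birkhoff theorems): $$h_\mu(x)=\lim_{\epsilon\to0}\liminf_{n\to\infty}-\frac1n\log\mu(B_n(x,\epsilon)),\qquad \varphi^*(x)=\lim_{n\to\infty}\frac1nS_n\varphi(x).$$ Point-wise measure theoretic pressure: $$P_\mu(f,\varphi,x)=\lim_{\epsilon\to0}\liminf_{n\to\infty}\frac1n\big[-\log\mu(B_n(x,\epsilon))+S_n\varphi(x)\big].$$ Measure theoretic pressure: for $Z\subset X$, $\alpha\in\mathbb{R}$, $N\in\mathbb{N}$, $\epsilon>0$ let $$M(Z,\varphi,\alpha,N,\epsilon)=\inf\Big\{\sum_i\exp\big(-\alpha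 n_i+S_{n_i}\varphi(x_i)\big):\bigcup_iB_{n_i}(x_i,\epsilon)\supset Z,\ x_i\in X,\ n_i\ge N\text{ for all }i\Big\},$$ the infimum being over finite or countable families $(x_i,n_i)_i$. Let $m(Z,\varphi,\alpha,\epsilon)=\lim_{N\to\infty}M(Z,\varphi,\alpha,N,\epsilon)$ and $P_Z(f,\varphi,\epsilon)=\inf\{\alpha:m(Z,\varphi,\alpha,\epsilon)=0\}=\sup\{\alpha:m(Z,\varphi,\alpha,\epsilon)=+\infty\}$. Let $P_\mu(f,\varphi,\epsilon)=\inf\{P_Z(f,\varphi,\epsilon):\mu(Z)=1\}$ and $P_\mu(f,\varphi)=\lim_{\epsilon\to0}P_\mu(f,\varphi,\epsilon)$. *)

theory Defs
  imports "HOL-Probability.Probability"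
begin

text \<open>
  The space \<open>X\<close> is the universe of a type of class \<^class>\<open>metric_space\<close>; its compactness is an
  explicit assumption of the theorem. Every quantity below is used only for \<open>n \<longlonglongrightarrow> \<infinity>\<close>, so the
  values at \<open>n = 0\<close> (where \<open>bowen_dist\<close> is the maximum of the empty set and \<open>1/n\<close> is a division
  by zero) are immaterial.
\<close>

definition birkhoff_sum :: "('a \<Rightarrow> 'a) \<Rightarrow> ('a \<Rightarrow> real) \<Rightarrow> nat \<Rightarrow> 'a \<Rightarrow> real" where
  "birkhoff_sum f \<phi> n x = (\<Sum>i<n. \<phi> ((f ^^ i) x))"

definition bowen_dist :: "('a::metric_space \<Rightarrow> 'a) \<Rightarrow> nat \<Rightarrow> 'a \<Rightarrow> 'a \<Rightarrow> real" where
  "bowen_dist f n x y = Max ((\<lambda>i. dist ((f ^^ i) x) ((f ^^ i) y)) ` {..<n})"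

definition bowen_ball :: "('a::metric_space \<Rightarrow> 'a) \<Rightarrow> nat \<Rightarrow> 'a \<Rightarrow> real \<Rightarrow> 'a set" where
  "bowen_ball f n x \<epsilon> = {y. bowen_dist f n x y < \<epsilon>}"


subsection \<open>Invariant measures, ergodicity and Kolmogorov--Sinai entropy\<close>

definition invariant_measures :: "('a::metric_space \<Rightarrow> 'a) \<Rightarrow> 'a measure set" where
  "invariant_measures f = {\<mu>. prob_space \<mu> \<and> sets \<mu> = sets borel \<and>
     (\<forall>A\<in>sets \<mu>. emeasure \<mu> (f -` A) = emeasure \<mu> A)}"

definition ergodic :: "'a measure \<Rightarrow> ('a \<Rightarrow> 'a) \<Rightarrow> bool" where
  "ergodic \<mu> f \<longleftrightarrow> (\<forall>A\<in>sets \<mu>. f -` A = A \<longrightarrow> measure \<mu> A = 0 \<or> measure \<mu> A = 1)"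

text \<open>Since \<open>0 * ln 0 = 0\<close>, null cells do not contribute to the entropy of a partition.\<close>

definition partition_entropy :: "'a measure \<Rightarrow> 'a set set \<Rightarrow> real" where
  "partition_entropy \<mu> P = - (\<Sum>A\<in>P. measure \<mu> A * ln (measure \<mu> A))"

text \<open>The join of the pulled back partitions \<open>f\<^sup>-\<^sup>i P\<close> for \<open>i < n\<close>.\<close>

definition iterated_join :: "('a \<Rightarrow> 'a) \<Rightarrow> 'a set set \<Rightarrow> nat \<Rightarrow> 'a set set" where
  "iterated_join f P n =
     common_refinement ((\<lambda>i. ((-`) (f ^^ i)) ` P - {{}}) ` {..<n})"

definition entropy_wrt_partition :: "'a measure \<Rightarrow> ('a \<Rightarrow> 'a) \<Rightarrow> 'a set set \<Rightarrow> real" where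
  "entropy_wrt_partition \<mu> f P =
     lim (\<lambda>n. partition_entropy \<mu> (iterated_join f P n) / real n)"

definition ks_entropy :: "'a measure \<Rightarrow> ('a \<Rightarrow> 'a) \<Rightarrow> ereal" where
  "ks_entropy \<mu> f =
     (SUP P\<in>{P. finite P \<and> P \<subseteq> sets \<mu> \<and> partition_on (space \<mu>) P}.
        ereal (entropy_wrt_partition \<mu> f P))"


subsection \<open>Local entropy, Birkhoff averages and point-wise pressure\<close>

text \<open>\<open>- log\<close> on \<open>[0, 1]\<close> with \<open>- log 0 = \<infinity>\<close>, in contrast to the library convention \<open>ln 0 = 0\<close>.\<close>

definition minus_ln :: "real \<Rightarrow> ereal" where
  "minus_ln p = (if p = 0 then \<infinity> else ereal (- ln p))"

definition local_entropy ::
    "'a::metric_space measure \<Rightarrow> ('a \<Rightarrow> 'a) \<Rightarrow> 'a \<Rightarrow> ereal" where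
  "local_entropy \<mu> f x =
     Lim (at_right 0) (\<lambda>\<epsilon>::real. liminf (\<lambda>n.
       ereal (1 / real n) * minus_ln (measure \<mu> (bowen_ball f n x \<epsilon>))))"

text \<open>The value is arbitrary on the null set where the averages diverge.\<close>

definition birkhoff_average :: "('a \<Rightarrow> 'a) \<Rightarrow> ('a \<Rightarrow> real) \<Rightarrow> 'a \<Rightarrow> real" where
  "birkhoff_average f \<phi> x = lim (\<lambda>n. 1 / real n * birkhoff_sum f \<phi> n x)"

definition pointwise_pressure ::
    "'a::metric_space measure \<Rightarrow> ('a \<Rightarrow> 'a) \<Rightarrow> ('a \<Rightarrow> real) \<Rightarrow> 'a \<Rightarrow> ereal" where
  "pointwise_pressure \<mu> f \<phi> x =
     Lim (at_right 0) (\<lambda>\<epsilon>::real. liminf (\<lambda>n.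
       ereal (1 / real n) *
         (minus_ln (measure \<mu> (bowen_ball f n x \<epsilon>)) + ereal (birkhoff_sum f \<phi> n x))))"


subsection \<open>Measure theoretic pressure\<close>

text \<open>
  Finite or countable families \<open>(x\<^sub>i, n\<^sub>i)\<close> are indexed by arbitrary sets \<open>I\<close> of natural numbers;
  values of \<open>xs\<close> and \<open>ns\<close> outside \<open>I\<close> play no role.
\<close>

definition cover_sum ::
    "('a::metric_space \<Rightarrow> 'a) \<Rightarrow> ('a \<Rightarrow> real) \<Rightarrow> 'a set \<Rightarrow> real \<Rightarrow> nat \<Rightarrow> real \<Rightarrow> ennreal" where
  "cover_sum f \<phi> Z \<alpha> N \<epsilon> =
     Inf {\<Sum>\<^sub>\<infinity>i\<in>I. ennreal (exp (- \<alpha> * real (ns i) + birkhoff_sum f \<phi> (ns i) (xs i)))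
          | (I :: nat set) (xs :: nat \<Rightarrow> 'a) (ns :: nat \<Rightarrow> nat).
            Z \<subseteq> (\<Union>i\<in>I. bowen_ball f (ns i) (xs i) \<epsilon>) \<and> (\<forall>i\<in>I. N \<le> ns i)}"

definition cover_limit ::
    "('a::metric_space \<Rightarrow> 'a) \<Rightarrow> ('a \<Rightarrow> real) \<Rightarrow> 'a set \<Rightarrow> real \<Rightarrow> real \<Rightarrow> ennreal" where
  "cover_limit f \<phi> Z \<alpha> \<epsilon> = lim (\<lambda>N. cover_sum f \<phi> Z \<alpha> N \<epsilon>)"

definition set_pressure ::
    "('a::metric_space \<Rightarrow> 'a) \<Rightarrow> ('a \<Rightarrow> real) \<Rightarrow> 'a set \<Rightarrow> real \<Rightarrow> ereal" where
  "set_pressure f \<phi> Z \<epsilon> = Inf (ereal ` {\<alpha>. cover_limit f \<phi> Z \<alpha> \<epsilon> = 0})"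

definition measure_pressure_at ::
    "'a::metric_space measure \<Rightarrow> ('a \<Rightarrow> 'a) \<Rightarrow> ('a \<Rightarrow> real) \<Rightarrow> real \<Rightarrow> ereal" where
  "measure_pressure_at \<mu> f \<phi> \<epsilon> =
     (INF Z\<in>{Z \<in> sets \<mu>. measure \<mu> Z = 1}. set_pressure f \<phi> Z \<epsilon>)"

definition measure_pressure ::
    "'a::metric_space measure \<Rightarrow> ('a \<Rightarrow> 'a) \<Rightarrow> ('a \<Rightarrow> real) \<Rightarrow> ereal" where
  "measure_pressure \<mu> f \<phi> = Lim (at_right 0) (measure_pressure_at \<mu> f \<phi>)"

end

theory Submission
  imports Defs
begin

text \<open>
  Up to the passage to the limit in \<open>\<epsilon>\<close>, the pressure of \<open>\<mu>\<close> is the essential supremum of the point-wise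
  pressures: points with \<open>\<mu>(B\<^sub>n(x, \<epsilon>)) > exp (S\<^sub>n \<phi> x - n s)\<close> for infinitely many \<open>n\<close> are covered economically
  by \<open>2\<epsilon>\<close>-balls around maximal separated sets, whose \<open>\<epsilon>\<close>-balls are disjoint; conversely, a mass
  distribution argument bounds covers of a set where the reverse inequality holds for all large \<open>n\<close>.
  Birkhoff's theorem then splits the point-wise pressure into local entropy and Birkhoff average.

  For ergodic \<open>\<mu>\<close>, local entropy decreases along orbits and hence is almost everywhere constant. Fatou's lemma,
  applied to the information functions of a partition finer than \<open>\<epsilon>\<close>, bounds it by \<open>h\<^sub>\<mu>(f)\<close>, so the
  Shannon--McMillan--Breiman theorem is not needed. The reverse inequality is the bound of \<open>h\<^sub>\<mu>(f)\<close> by the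
  pressure of \<open>\<mu>\<close> for the potential 0: an economical cover by Bowen balls yields a prefix code for the
  itineraries with respect to any partition, the orbit segments being parsed greedily into Bowen balls, and
  Gibbs' inequality compares the entropy of the itineraries with the code length.
\<close>

section \<open>Subadditive sequences, regularity of Borel measures, words\<close>

text \<open>Two mismatches shape the bound of entropy by pressure. A point of a Bowen ball need not
  have the itinerary of the center, since Borel cells can be arbitrarily intertwined. Closed subsets
  of the cells, however, are a positive distance apart, so the orbit of the center predicts each
  letter read at a point of their union; the other times are rare on average and each costs the
  constant \<open>ln (card P / \<theta>)\<close>. Secondly, infinite covers have unbounded block
  lengths. They are cut off to finite ones, and uncovered points, again of small measure, are coded
  letter by letter. Errors of both kinds are counted by visits to a set, whose mean is n times its
  measure. The same parsing lemma proves Birkhoff's theorem; there the blocks are finite times at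
  which the average nearly attains its upper limit. The formula for the pressure of \<mu> precedes
  the results on entropy, because for the potential 0 it turns the bound of entropy by pressure into
  a lower bound for the essential supremum of local entropy.\<close>

lemma fekete_subadditive:
  fixes u :: "nat \<Rightarrow> real"
  assumes sub: "\<And>m n. u (m + n) \<le> u m + u n" and nonneg: "\<And>n. 0 \<le> u n"
  shows "convergent (\<lambda>n. u n / real n)"
proof -
  define l where "l = (INF n\<in>{1..}. u n / real n)"
  have bdd: "bdd_below ((\<lambda>n. u n / real n) ` {1..})"
    by (rule bdd_belowI2[of _ 0]) (auto simp: nonneg)
  have lower: "l \<le> u n / real n" if "n \<ge> 1" for n
    unfolding l_def using that by (intro cINF_lower[OF bdd]) auto
  have mult: "u (q * k) \<le> real q * u k" if "q \<ge> 1" for q k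
    using that
  proof (induction q rule: dec_induct)
    case (step q)
    have "u (Suc q * k) \<le> u k + u (q * k)" using sub[of k "q * k"] by simp
    also have "\<dots> \<le> real (Suc q) * u k" using step by (simp add: algebra_simps)
    finally show ?case .
  qed simp
  have "(\<lambda>n. u n / real n) \<longlonglongrightarrow> l"
  proof (rule LIMSEQ_I)
    fix r :: real assume r: "0 < r"
    obtain k where k: "k \<ge> 1" "u k / real k < l + r / 2"
      using cINF_less_iff[OF _ bdd, of "l + r / 2"] r by (auto simp: l_def)
    \<comment> \<open>\<open>B\<close> bounds \<open>u\<close> at every remainder modulo
      \<open>k\<close>, so the incomplete last block costs at most \<open>B / n\<close> after
      division by \<open>n\<close>.\<close>
    define B where "B = (\<Sum>j<2 * k. u j)"
    have B: "u j \<le> B" if "j < 2 * k" for j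
      unfolding B_def using that nonneg by (intro member_le_sum) auto
    have B0: "0 \<le> B" unfolding B_def by (intro sum_nonneg nonneg)
    obtain N0 :: nat where N0: "real N0 > 2 * B / r" using reals_Archimedean2 by blast
    define N where "N = max N0 (2 * k)"
    have N: "real N > 2 * B / r" "N \<ge> 2 * k"
      using N0 by (auto simp: N_def)
    show "\<exists>no. \<forall>n\<ge>no. norm (u n / real n - l) < r"
    proof (intro exI allI impI)
      fix n assume n: "N \<le> n"
      have n0: "real n > 0" using n N k by linarith
      have q: "n div k \<ge> 1" using n N k by (simp add: div_greater_zero_iff Suc_le_eq)
      have "u n = u ((n div k) * k + n mod k)" by simp
      also have "\<dots> \<le> u ((n div k) * k) + u (n mod k)" by (rule sub)
      also have "\<dots> \<le> real (n div k) * u k + B"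
      proof -
        have "n mod k < k" using k by simp
        then have "n mod k < 2 * k" by simp
        then show ?thesis using mult[OF q] B by (intro add_mono) auto
      qed
      also have "real (n div k) * u k = real (n div k * k) * (u k / real k)" using k by simp
      also have "\<dots> \<le> real n * (u k / real k)"
        by (intro mult_right_mono) (auto simp: nonneg simp del: of_nat_mult)
      finally have "u n / real n \<le> u k / real k + B / real n"
        using n0 by (simp add: field_simps)
      moreover have "B / real n < r / 2"
      proof -
        have "real n > 2 * B / r" using N n by linarith
        then show ?thesis using r n0 by (simp add: field_simps)
      qed
      ultimately have "u n / real n < l + r" using k by linarith
      moreover have "l \<le> u n / real n" using lower[of n] n N k by simp
      ultimately show "norm (u n / real n - l) < r" by simp
    qed
  qed
  then show ?thesis by (auto simp: convergent_def)
qed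

section \<open>Limits as the radius tends to 0\<close>

text \<open>All limits \<epsilon> \<rightarrow> 0 in the definitions are of quantities that grow as
  \<epsilon> shrinks. They are therefore suprema, always exist in \<open>ereal\<close>, and
  \<open>Lim\<close> never takes a default value.\<close>

lemma tendsto_at_right_0_SUP:
  fixes F :: "real \<Rightarrow> ereal"
  assumes anti: "\<And>a b. 0 < a \<Longrightarrow> a \<le> b \<Longrightarrow> F b \<le> F a"
  shows "(F \<longlongrightarrow> (SUP \<epsilon>\<in>{0<..}. F \<epsilon>)) (at_right 0)"
proof (rule order_tendstoI)
  fix a assume "a < (SUP \<epsilon>\<in>{0<..}. F \<epsilon>)"
  then obtain e where e: "e > 0" "a < F e" by (auto simp: less_SUP_iff)
  then have "\<forall>y>0. y < e \<longrightarrow> a < F y" using anti by (meson less_imp_le less_le_trans)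
  then show "eventually (\<lambda>x. a < F x) (at_right 0)"
    unfolding eventually_at_right_field using e by auto
next
  fix a assume a: "(SUP \<epsilon>\<in>{0<..}. F \<epsilon>) < a"
  then have "\<forall>y>0. F y < a" by (metis SUP_lessD greaterThan_iff)
  then show "eventually (\<lambda>x. F x < a) (at_right 0)"
    unfolding eventually_at_right_field by (auto intro: exI[of _ 1])
qed

lemma Lim_at_right_0_SUP:
  fixes F :: "real \<Rightarrow> ereal"
  assumes "\<And>a b. 0 < a \<Longrightarrow> a \<le> b \<Longrightarrow> F b \<le> F a"
  shows "Lim (at_right 0) F = (SUP \<epsilon>\<in>{0<..}. F \<epsilon>)"
  by (intro tendsto_Lim tendsto_at_right_0_SUP assms) auto

text \<open>Countably many radii suffice, which gives measurability and lets the supremum be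
  exchanged with "almost everywhere".\<close>

lemma SUP_at_right_0_eq_inverse_Suc:
  fixes F :: "real \<Rightarrow> ereal"
  assumes anti: "\<And>a b. 0 < a \<Longrightarrow> a \<le> b \<Longrightarrow> F b \<le> F a"
  shows "(SUP \<epsilon>\<in>{0<..}. F \<epsilon>) = (SUP k. F (1 / real (Suc k)))"
proof (intro antisym SUP_least)
  fix e :: real assume "e \<in> {0<..}"
  then obtain k where "1 / real (Suc k) < e" by (metis greaterThan_iff nat_approx_posE)
  then show "F e \<le> (SUP k. F (1 / real (Suc k)))"
    by (intro SUP_upper2[of k] anti) auto
next
  fix k show "F (1 / real (Suc k)) \<le> (SUP \<epsilon>\<in>{0<..}. F \<epsilon>)"
    by (intro SUP_upper) auto
qed

section \<open>Regularity of finite Borel measures on metric spaces\<close>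

text \<open>Sets squeezed between a closed and an open set with small difference form a
  \<sigma>-algebra that contains the closed sets. Asking for both approximations at once makes the
  complement step symmetric.\<close>

lemma closed_open_approximation:
  fixes M :: "'a::metric_space measure"
  assumes fin: "finite_measure M" and sets: "sets M = sets borel" and A: "A \<in> sets M"
    and e: "0 < e"
  shows "\<exists>F U. closed F \<and> open U \<and> F \<subseteq> A \<and> A \<subseteq> U \<and> measure M (U - F) < e"
proof -
  interpret finite_measure M by fact
  have [simp]: "space M = UNIV" using sets_eq_imp_space_eq[OF sets] by simp
  have op: "open U \<Longrightarrow> U \<in> sets M" for U using sets by simp
  have cl: "closed U \<Longrightarrow> U \<in> sets M" for U using sets by simp
  have "A \<in> sigma_sets UNIV {S. closed S}"
    using A sets borel_eq_closed by (metis (no_types, lifting) sets_measure_of top_greatest Pow_UNIV)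
  then show ?thesis using e
  proof (induction arbitrary: e)
    case (Basic A)
    then have clA: "closed A" by simp
    show ?case
    proof (cases "A = {}")
      case True
      then show ?thesis using Basic.prems by (intro exI[of _ "{}"]) auto
    next
      case False
      \<comment> \<open>A closed set is the intersection of these open neighborhoods, so their
        measures decrease to its own.\<close>
      define U where "U n = {x. infdist x A < 1 / real (Suc n)}" for n
      have oU: "open (U n)" for n unfolding U_def
        by (intro open_Collect_less continuous_intros)
      have INT: "(\<Inter>n. U n) = A"
      proof (intro equalityI subsetI)
        fix x assume "x \<in> (\<Inter>n. U n)"
        then have "infdist x A < 1 / real (Suc n)" for n by (auto simp: U_def)
        then have "infdist x A \<le> 0"
          by (meson nat_approx_posE not_less order.strict_trans less_irrefl)
        then have "infdist x A = 0" using infdist_nonneg[of x A] by linarith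
        then show "x \<in> A" using in_closed_iff_infdist_zero[OF clA False] by simp
      qed (auto simp: U_def infdist_zero)
      have "(\<lambda>n. measure M (U n)) \<longlonglongrightarrow> measure M (\<Inter>n. U n)"
      proof (rule finite_Lim_measure_decseq)
        show "decseq U"
          unfolding U_def decseq_def
          by (force elim!: order.strict_trans2 intro!: divide_left_mono)
      qed (use oU op in auto)
      then have "eventually (\<lambda>n. measure M (U n) < measure M A + e) sequentially"
        using Basic.prems INT by (intro order_tendstoD(2)) auto
      then obtain n where "measure M (U n) < measure M A + e"
        by (meson eventually_happens trivial_limit_sequentially)
      moreover have "A \<subseteq> U n" using INT by auto
      moreover have "measure M (U n - A) = measure M (U n) - measure M A"
        using oU op cl clA \<open>A \<subseteq> U n\<close> by (intro finite_measure_Diff) auto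
      ultimately show ?thesis using clA oU[of n] by (intro exI[of _ A] exI[of _ "U n"]) auto
    qed
  next
    case Empty
    then show ?case by (intro exI[of _ "{}"]) auto
  next
    case (Compl A)
    obtain F U where "closed F" "open U" "F \<subseteq> A" "A \<subseteq> U" "measure M (U - F) < e"
      using Compl.IH[OF Compl.prems] by blast
    moreover have "- F - - U = U - F" by auto
    ultimately show ?case
      by (intro exI[of _ "- U"] exI[of _ "- F"]) (auto simp: open_Compl closed_Compl)
  next
    case (Union A)
    \<comment> \<open>These errors sum to \<open>e / 4\<close>, which leaves \<open>e / 2\<close>
      for the truncation below with room to spare.\<close>
    have "\<exists>F U. closed F \<and> open U \<and> F \<subseteq> A n \<and> A n \<subseteq> U \<and> measure M (U - F) < e / 4 * (1/2) ^ Suc n" for n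
      using Union.prems by (intro Union.IH) auto
    then obtain F U where FU: "closed (F n)" "open (U n)" "F n \<subseteq> A n" "A n \<subseteq> U n"
        "measure M (U n - F n) < e / 4 * (1/2) ^ Suc n" for n by metis
    have FM: "F n \<in> sets M" and UM: "U n \<in> sets M" for n using FU cl op by auto
    \<comment> \<open>A countable union of closed sets need not be closed, so only finitely many of
      them are kept.\<close>
    have "(\<lambda>n. measure M (\<Union>i\<le>n. F i)) \<longlonglongrightarrow> measure M (\<Union>n. \<Union>i\<le>n. F i)"
    proof (rule finite_Lim_measure_incseq)
      show "incseq (\<lambda>n. \<Union>i\<le>n. F i)"
        by (intro incseq_SucI UN_mono) auto
    qed (use FM in auto)
    moreover have UNeq: "(\<Union>n. \<Union>i\<le>n. F i) = (\<Union>n. F n)" by auto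
    ultimately have "eventually (\<lambda>n. measure M (\<Union>n. F n) - e / 2 < measure M (\<Union>i\<le>n. F i)) sequentially"
      using Union.prems by (intro order_tendstoD(1)) auto
    then obtain N where N: "measure M (\<Union>n. F n) - e / 2 < measure M (\<Union>i\<le>N. F i)"
      by (meson eventually_happens trivial_limit_sequentially)
    define G where "G = (\<Union>i\<le>N. F i)"
    have clG: "closed G" unfolding G_def using FU by (intro closed_UN) auto
    have sm: "summable (\<lambda>n. e / 4 * (1/2) ^ Suc n)"
      by (intro summable_mult) simp
    have sums: "(\<lambda>n. e / 4 * (1/2) ^ Suc n) sums (e / 4)"
      using sums_mult[OF power_half_series, of "e / 4"] by simp
    have sm': "summable (\<lambda>n. measure M (U n - F n))"
      using FU(5) by (intro summable_comparison_test'[OF sm]) (auto intro: less_imp_le)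
    have "measure M (\<Union>n. U n - F n) \<le> (\<Sum>n. measure M (U n - F n))"
      using FM UM sm' by (intro finite_measure_subadditive_countably) auto
    also have "\<dots> \<le> (\<Sum>n. e / 4 * (1/2) ^ Suc n)"
      using FU(5) by (intro suminf_le[OF _ sm' sm]) (auto intro: less_imp_le)
    also have "\<dots> = e / 4" using sums by (simp add: sums_iff)
    finally have 1: "measure M (\<Union>n. U n - F n) \<le> e / 4" .
    have 2: "measure M ((\<Union>n. F n) - G) < e / 2"
    proof -
      have "measure M ((\<Union>n. F n) - G) = measure M (\<Union>n. F n) - measure M G"
        using FM clG cl unfolding G_def by (intro finite_measure_Diff) auto
      then show ?thesis using N G_def by simp
    qed
    have "measure M ((\<Union>n. U n) - G) \<le> measure M ((\<Union>n. U n - F n) \<union> ((\<Union>n. F n) - G))"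
      using FM UM clG cl by (intro finite_measure_mono) auto
    also have "\<dots> \<le> measure M (\<Union>n. U n - F n) + measure M ((\<Union>n. F n) - G)"
      using FM UM clG cl by (intro measure_Un_le) auto
    finally have "measure M ((\<Union>n. U n) - G) < e" using 1 2 Union.prems by linarith
    moreover have "open (\<Union>n. U n)" "G \<subseteq> (\<Union>n. A n)" "(\<Union>n. A n) \<subseteq> (\<Union>n. U n)"
      using FU(2-4) by (auto simp: G_def) blast+
    ultimately show ?case using clG by blast
  qed
qed

lemma closed_inner_approximation:
  fixes M :: "'a::metric_space measure"
  assumes "finite_measure M" and "sets M = sets borel" and "A \<in> sets M" and "0 < e"
  obtains F where "closed F" "F \<subseteq> A" "measure M (A - F) < e"
proof -
  interpret finite_measure M by fact
  obtain F U where FU: "closed F" "open U" "F \<subseteq> A" "A \<subseteq> U" "measure M (U - F) < e"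
    using closed_open_approximation[OF assms] by blast
  have "measure M (A - F) \<le> measure M (U - F)"
    using FU assms by (intro finite_measure_mono) auto
  then show ?thesis using FU that by auto
qed

section \<open>Words over a finite alphabet\<close>

abbreviation words :: "'b set \<Rightarrow> nat \<Rightarrow> 'b list set" where
  "words P n \<equiv> {w. set w \<subseteq> P \<and> length w = n}"

lemma words_0: "words P 0 = {[]}"
  by auto

lemma sum_words_append:
  assumes "finite P"
  shows "(\<Sum>w\<in>words P (m + n). F w) = (\<Sum>u\<in>words P m. \<Sum>v\<in>words P n. F (u @ v))"
proof -
  have "(\<Sum>u\<in>words P m. \<Sum>v\<in>words P n. F (u @ v)) =
      (\<Sum>(u, v)\<in>words P m \<times> words P n. F (u @ v))"
    by (rule sum.cartesian_product)
  also have "\<dots> = (\<Sum>w\<in>words P (m + n). F w)"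
    by (rule sum.reindex_bij_witness[where i = "\<lambda>w. (take m w, drop m w)" and j = "\<lambda>(u, v). u @ v"])
      (auto dest: in_set_takeD in_set_dropD)
  finally show ?thesis by simp
qed

lemma sum_words_prod:
  fixes t :: "nat \<Rightarrow> 'b \<Rightarrow> real"
  assumes "finite P"
  shows "(\<Sum>w\<in>words P m. \<Prod>j<m. t j (w ! j)) = (\<Prod>j<m. \<Sum>b\<in>P. t j b)"
proof (induction m)
  case 0
  show ?case unfolding words_0 by simp
next
  case (Suc m)
  have w1: "words P (Suc 0) = (\<lambda>b. [b]) ` P"
    by (auto simp: length_Suc_conv)
  have "(\<Sum>w\<in>words P (m + Suc 0). \<Prod>j<Suc m. t j (w ! j)) =
      (\<Sum>u\<in>words P m. \<Sum>v\<in>words P (Suc 0). \<Prod>j<Suc m. t j ((u @ v) ! j))"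
    by (rule sum_words_append[OF assms])
  also have "\<dots> = (\<Sum>u\<in>words P m. \<Sum>b\<in>P. (\<Prod>j<m. t j (u ! j)) * t m b)"
    unfolding w1
    by (intro sum.cong refl, subst sum.reindex) (auto simp: inj_on_def nth_append)
  also have "\<dots> = (\<Prod>j<Suc m. \<Sum>b\<in>P. t j b)"
    using Suc by (simp add: sum_distrib_left[symmetric] sum_distrib_right[symmetric])
  finally show ?case by simp
qed

section \<open>Birkhoff's ergodic theorem\<close>

locale pmp_system = prob_space M for M :: "'a measure" +
  fixes f :: "'a \<Rightarrow> 'a"
  assumes space_UNIV: "space M = UNIV"
    and measurable_f [measurable]: "f \<in> measurable M M"
    and preserving: "A \<in> sets M \<Longrightarrow> emeasure M (f -` A) = emeasure M A"
begin

lemma measurable_iterate [measurable]: "f ^^ n \<in> measurable M M"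
  by (induction n) (auto intro: measurable_comp[OF _ measurable_f])

lemma Compl_sets: "A \<in> sets M \<Longrightarrow> - A \<in> sets M"
  using sets.compl_sets[of A M] by (simp add: space_UNIV Compl_eq_Diff_UNIV)

lemma vimage_iterate_sets: "A \<in> sets M \<Longrightarrow> (f ^^ n) -` A \<in> sets M"
  using measurable_sets[OF measurable_iterate[of n], of A] by (simp add: space_UNIV)

lemma distr_iterate: "distr M M (f ^^ n) = M"
proof (induction n)
  case (Suc n)
  have "distr M M f = M"
    by (intro measure_eqI) (auto simp: emeasure_distr preserving space_UNIV)
  moreover have "distr M M (f ^^ Suc n) = distr (distr M M (f ^^ n)) M f"
    by (simp add: distr_distr del: o_apply)
  ultimately show ?case unfolding Suc by (simp only:)
qed (simp add: distr_id2 id_def)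

lemma measure_vimage_iterate: "A \<in> sets M \<Longrightarrow> measure M ((f ^^ n) -` A) = measure M A"
  using measure_distr[OF measurable_iterate, of A n] distr_iterate[of n] by (simp add: space_UNIV)

lemma integral_iterate:
  fixes g :: "'a \<Rightarrow> real"
  assumes "g \<in> borel_measurable M"
  shows "(\<integral>x. g ((f ^^ n) x) \<partial>M) = (\<integral>x. g x \<partial>M)"
  using integral_distr[OF measurable_iterate assms, of n] distr_iterate[of n] by simp

lemma AE_iterate:
  assumes "AE x in M. P x"
  shows "AE x in M. \<forall>n. P ((f ^^ n) x)"
proof -
  have "AE x in M. P ((f ^^ n) x)" for n
  proof -
    have "AE x in distr M M (f ^^ n). P x" using assms unfolding distr_iterate .
    then show ?thesis by (rule AE_distrD[OF measurable_iterate])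
  qed
  then show ?thesis by (simp add: AE_all_countable)
qed

section \<open>Visits to a set and parsing of orbit segments\<close>

definition visits :: "'a set \<Rightarrow> nat \<Rightarrow> 'a \<Rightarrow> real" where
  "visits A n x = (\<Sum>i<n. indicator A ((f ^^ i) x))"

lemma visits_measurable [measurable]:
  assumes [measurable]: "A \<in> sets M"
  shows "visits A n \<in> borel_measurable M"
  unfolding visits_def by measurable

lemma visits_nonneg: "0 \<le> visits A n x"
  unfolding visits_def by (intro sum_nonneg) auto

lemma visits_le: "visits A n x \<le> real n"
  unfolding visits_def using sum_bounded_above[of "{..<n}" "\<lambda>i. indicator A ((f ^^ i) x)" "1::real"]
  by (simp add: indicator_def)

lemma visits_add: "visits A (m + n) x = visits A m x + visits A n ((f ^^ m) x)"
  unfolding visits_def lessThan_atLeast0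
  using sum.atLeastLessThan_concat[of 0 m "m + n" "\<lambda>i. indicator A ((f ^^ i) x) :: real"]
    sum.shift_bounds_nat_ivl[of "\<lambda>i. indicator A ((f ^^ i) x) :: real" 0 m n]
  by (simp add: funpow_add add.commute)

lemma visits_1: "visits A (Suc 0) x = indicator A x"
  by (simp add: visits_def)

lemma visits_integrable: "A \<in> sets M \<Longrightarrow> integrable M (visits A n)"
  by (intro integrable_const_bound[of _ "real n"]) (auto simp: visits_nonneg visits_le)

lemma integral_visits:
  assumes [measurable]: "A \<in> sets M"
  shows "(\<integral>x. visits A n x \<partial>M) = real n * measure M A"
proof -
  have int: "integrable M (\<lambda>x. indicator A ((f ^^ i) x) :: real)" for i
    by (intro integrable_const_bound[of _ 1]) (auto simp: indicator_def)
  have "(\<integral>x. visits A n x \<partial>M) = (\<Sum>i<n. \<integral>x. indicator A ((f ^^ i) x) \<partial>M)"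
    unfolding visits_def by (rule Bochner_Integration.integral_sum) (rule int)
  also have "\<dots> = (\<Sum>i<n. measure M A)"
    by (intro sum.cong refl, subst integral_iterate) (auto simp: space_UNIV)
  finally show ?thesis by simp
qed

text \<open>Reading an orbit segment from the left, a block of zero cost is removed whenever the current
  point is good; only the bad points and the last \<open>N\<close> points are paid for.\<close>

lemma greedy_parsing:
  fixes L :: "nat \<Rightarrow> 'a \<Rightarrow> real"
  assumes L0: "\<And>x. L 0 x \<le> 0" and K: "0 \<le> K"
    and step: "\<And>n x. L (Suc n) x \<le> K + L n (f x)"
    and block: "\<And>x. x \<notin> A \<Longrightarrow> \<exists>m\<in>{1..N}. \<forall>n. L (m + n) x \<le> L n ((f ^^ m) x)"
  shows "L n x \<le> K * (visits A n x + real N)"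
proof (induction n arbitrary: x rule: less_induct)
  case (less n)
  have short: "L k y \<le> K * real k" for k y
  proof (induction k arbitrary: y)
    case (Suc k)
    have "L (Suc k) y \<le> K + L k (f y)" by (rule step)
    also have "\<dots> \<le> K + K * real k" using Suc by simp
    finally show ?case by (simp add: algebra_simps)
  qed (simp add: L0)
  show ?case
  \<comment> \<open>A block may be longer than what remains of the segment, so at most
    \<open>N\<close> final points are paid for one by one.\<close>
  proof (cases "n \<le> N")
    case True
    have "L n x \<le> K * real n" by (rule short)
    also have "\<dots> \<le> K * (visits A n x + real N)"
      using K True visits_nonneg[of A n x] by (intro mult_left_mono) auto
    finally show ?thesis .
  next
    case False
    show ?thesis
    proof (cases "x \<in> A")
      case True
      obtain k where k: "n = Suc k" using False by (cases n) auto
      have "L n x \<le> K + L k (f x)" unfolding k by (rule step)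
      also have "\<dots> \<le> K + K * (visits A k (f x) + real N)" using less[of k "f x"] k by simp
      also have "visits A k (f x) = visits A n x - 1"
        using visits_add[of A "Suc 0" k x] True by (simp add: k visits_1)
      finally show ?thesis by (simp add: algebra_simps)
    next
      case x: False
      obtain m where m: "m \<in> {1..N}" "\<And>k. L (m + k) x \<le> L k ((f ^^ m) x)" using block[OF x] by blast
      define k where "k = n - m"
      have n: "n = m + k" "k < n" using m False by (auto simp: k_def)
      have "L n x \<le> L k ((f ^^ m) x)" unfolding n(1) by (rule m)
      also have "\<dots> \<le> K * (visits A k ((f ^^ m) x) + real N)" by (rule less) (use n in auto)
      also have "\<dots> \<le> K * (visits A n x + real N)"
        using K visits_add[of A m k x] visits_nonneg[of A m x] n(1) by (intro mult_left_mono) auto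
      finally show ?thesis .
    qed
  qed
qed

text \<open>In use, \<open>G m\<close> holds the points where a good block of length
  \<open>m\<close> starts. These lengths are finite but unbounded; truncating them at
  \<open>N\<close> leaves a bad set of vanishing measure, as \<open>greedy_parsing\<close> requires
  bounded blocks.\<close>

lemma measure_never_tendsto_0:
  fixes G :: "nat \<Rightarrow> 'a set"
  assumes [measurable]: "\<And>m. G m \<in> sets M" and "AE x in M. \<exists>m. x \<in> G m"
  shows "(\<lambda>N. measure M (- (\<Union>m\<le>N. G m))) \<longlonglongrightarrow> 0"
proof -
  have "(\<lambda>N. measure M (- (\<Union>m\<le>N. G m))) \<longlonglongrightarrow> measure M (\<Inter>N. - (\<Union>m\<le>N. G m))"
  proof (rule finite_Lim_measure_decseq)
    show "decseq (\<lambda>N. - (\<Union>m\<le>N. G m))"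
      by (intro decseq_SucI) auto
  qed (auto intro!: Compl_sets)
  also have "measure M (\<Inter>N. - (\<Union>m\<le>N. G m)) = measure M {x \<in> space M. \<not> (\<exists>m. x \<in> G m)}"
    by (intro arg_cong[where f = "measure M"]) (auto simp: space_UNIV)
  also have "\<dots> = 0"
  proof -
    have "{x \<in> space M. \<not> (\<exists>m. x \<in> G m)} \<in> sets M" by measurable
    then show ?thesis
      using assms(2) AE_iff_null[of M "\<lambda>x. \<exists>m. x \<in> G m"] by (intro measure_eq_0_null_sets) simp
  qed
  finally show ?thesis .
qed

lemma birkhoff_sum_measurable [measurable]:
  assumes [measurable]: "\<phi> \<in> borel_measurable M"
  shows "birkhoff_sum f \<phi> n \<in> borel_measurable M"
  unfolding birkhoff_sum_def by measurable

lemma birkhoff_sum_add: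
  "birkhoff_sum f \<phi> (m + n) x = birkhoff_sum f \<phi> m x + birkhoff_sum f \<phi> n ((f ^^ m) x)"
  unfolding birkhoff_sum_def lessThan_atLeast0
  using sum.atLeastLessThan_concat[of 0 m "m + n" "\<lambda>i. \<phi> ((f ^^ i) x)"]
    sum.shift_bounds_nat_ivl[of "\<lambda>i. \<phi> ((f ^^ i) x)" 0 m n]
  by (simp add: funpow_add add.commute)

lemma birkhoff_sum_bound:
  assumes "\<And>x. \<bar>\<phi> x\<bar> \<le> C"
  shows "\<bar>birkhoff_sum f \<phi> n x\<bar> \<le> real n * C"
proof -
  have "\<bar>birkhoff_sum f \<phi> n x\<bar> \<le> (\<Sum>i<n. \<bar>\<phi> ((f ^^ i) x)\<bar>)"
    unfolding birkhoff_sum_def by (rule sum_abs)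
  also have "\<dots> \<le> (\<Sum>i<n. C)" by (intro sum_mono assms)
  finally show ?thesis by simp
qed

lemma integral_birkhoff_sum:
  assumes [measurable]: "\<phi> \<in> borel_measurable M" and bd: "\<And>x. \<bar>\<phi> x\<bar> \<le> C"
  shows "(\<integral>x. birkhoff_sum f \<phi> n x \<partial>M) = real n * (\<integral>x. \<phi> x \<partial>M)"
proof -
  have int: "integrable M (\<lambda>x. \<phi> ((f ^^ i) x))" for i
    by (intro integrable_const_bound[of _ C]) (auto simp: bd)
  have "(\<integral>x. birkhoff_sum f \<phi> n x \<partial>M) = (\<Sum>i<n. \<integral>x. \<phi> ((f ^^ i) x) \<partial>M)"
    unfolding birkhoff_sum_def by (rule Bochner_Integration.integral_sum) (rule int)
  also have "\<dots> = (\<Sum>i<n. \<integral>x. \<phi> x \<partial>M)"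
    by (intro sum.cong refl integral_iterate) auto
  finally show ?thesis by simp
qed

section \<open>Upper averages and the ergodic theorem\<close>

definition upper_average :: "('a \<Rightarrow> real) \<Rightarrow> 'a \<Rightarrow> ereal" where
  "upper_average \<phi> x = limsup (\<lambda>n. ereal (1 / real n * birkhoff_sum f \<phi> n x))"

lemma upper_average_measurable [measurable]:
  assumes [measurable]: "\<phi> \<in> borel_measurable M"
  shows "upper_average \<phi> \<in> borel_measurable M"
  unfolding upper_average_def by measurable

lemma average_bound:
  assumes bd: "\<And>x. \<bar>\<phi> x\<bar> \<le> C"
  shows "\<bar>1 / real n * birkhoff_sum f \<phi> n x\<bar> \<le> C"
proof (cases "n = 0")
  case True
  then show ?thesis using bd[of x] by simp
next
  case False
  then show ?thesis
    using birkhoff_sum_bound[of \<phi> C n x, OF bd] by (simp add: abs_mult field_simps)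
qed

lemma upper_average_bound:
  assumes bd: "\<And>x. \<bar>\<phi> x\<bar> \<le> C"
  shows "ereal (- C) \<le> upper_average \<phi> x" "upper_average \<phi> x \<le> ereal C"
proof -
  have *: "- C \<le> 1 / real n * birkhoff_sum f \<phi> n x \<and> 1 / real n * birkhoff_sum f \<phi> n x \<le> C" for n
    using average_bound[of \<phi> C n x, OF bd] unfolding abs_le_iff by linarith
  show "upper_average \<phi> x \<le> ereal C"
    unfolding upper_average_def by (intro Limsup_bounded) (use * in auto)
  have "ereal (- C) \<le> liminf (\<lambda>n. ereal (1 / real n * birkhoff_sum f \<phi> n x))"
    by (intro Liminf_bounded) (use * in auto)
  also have "\<dots> \<le> upper_average \<phi> x"
    unfolding upper_average_def by (intro Liminf_le_Limsup) auto
  finally show "ereal (- C) \<le> upper_average \<phi> x" .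
qed

text \<open>The sum of length n + 1 at \<open>x\<close> is the sum of length n at \<open>f x\<close>
  plus the single term \<open>\<phi> x\<close>, so the two averages differ by at most
  \<open>2 * C / n\<close>.\<close>

lemma upper_average_invariant:
  assumes bd: "\<And>x. \<bar>\<phi> x\<bar> \<le> C"
  shows "upper_average \<phi> (f x) = upper_average \<phi> x"
proof -
  define a where "a n y = 1 / real n * birkhoff_sum f \<phi> n y" for n y
  have diff: "(\<lambda>n. ereal (a n (f x) - a (Suc n) x)) \<longlonglongrightarrow> ereal 0"
  proof (rule tendsto_ereal, rule Lim_null_comparison)
    show "\<forall>\<^sub>F n in sequentially. norm (a n (f x) - a (Suc n) x) \<le> 2 * C / real n"
    proof (rule eventually_sequentiallyI[of 1])
      fix n :: nat assume n: "1 \<le> n"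
      have S: "birkhoff_sum f \<phi> (Suc n) x = \<phi> x + birkhoff_sum f \<phi> n (f x)"
        using birkhoff_sum_add[of \<phi> "Suc 0" n x] by (simp add: birkhoff_sum_def)
      have "a n (f x) - a (Suc n) x = a n (f x) * (1 / real (Suc n)) - \<phi> x / real (Suc n)"
      proof -
        have "1 / real n - 1 / real (Suc n) = 1 / real n * (1 / real (Suc n))"
          using n by (simp add: divide_simps)
        moreover have "a n (f x) - a (Suc n) x =
            birkhoff_sum f \<phi> n (f x) * (1 / real n - 1 / real (Suc n)) - \<phi> x / real (Suc n)"
          unfolding a_def S by (simp add: algebra_simps add_divide_distrib)
        ultimately show ?thesis unfolding a_def by (simp add: mult.commute mult.left_commute)
      qed
      also have "\<bar>\<dots>\<bar> \<le> \<bar>a n (f x)\<bar> * (1 / real (Suc n)) + \<bar>\<phi> x\<bar> / real (Suc n)"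
        by (rule order_trans[OF abs_triangle_ineq4]) (simp add: abs_mult)
      also have "\<dots> \<le> C * (1 / real (Suc n)) + C / real (Suc n)"
        using average_bound[of \<phi> C n "f x", OF bd] bd[of x] unfolding a_def
        by (intro add_mono mult_right_mono divide_right_mono) auto
      also have "\<dots> = 2 * C / real (Suc n)" by simp
      also have "\<dots> \<le> 2 * C / real n"
        using n order_trans[OF abs_ge_zero bd[of x]] by (intro divide_left_mono) auto
      finally show "norm (a n (f x) - a (Suc n) x) \<le> 2 * C / real n" by simp
    qed
    show "(\<lambda>n. 2 * C / real n) \<longlonglongrightarrow> 0" by (rule lim_const_over_n)
  qed
  have "upper_average \<phi> (f x) = limsup (\<lambda>n. ereal (a n (f x) - a (Suc n) x) + ereal (a (Suc n) x))"
    unfolding upper_average_def a_def[symmetric] by simp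
  also have "\<dots> = ereal 0 + limsup (\<lambda>n. ereal (a (Suc n) x))"
    by (rule ereal_limsup_lim_add[OF diff]) auto
  also have "limsup (\<lambda>n. ereal (a (Suc n) x)) = upper_average \<phi> x"
    unfolding upper_average_def a_def[symmetric] 
    using limsup_shift[of "\<lambda>n. ereal (a n x)"] by simp
  finally show ?thesis by simp
qed

text \<open>At every point some finite block has average above
  \<open>upper_average \<phi> x - \<delta>\<close>, by the meaning of the upper limit. Since the
  upper average is constant along the orbit, such blocks can be strung together, and a long Birkhoff
  sum falls short of \<open>n\<close> times this value only by what the bad points and the last
  block cost.\<close>

lemma integral_upper_average_le:
  assumes [measurable]: "\<phi> \<in> borel_measurable M" and bd: "\<And>x. \<bar>\<phi> x\<bar> \<le> C"
  shows "(\<integral>x. real_of_ereal (upper_average \<phi> x) \<partial>M) \<le> (\<integral>x. \<phi> x \<partial>M)"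
proof (rule field_le_epsilon)
  fix \<delta> :: real assume \<delta>: "0 < \<delta>"
  define \<psi> where "\<psi> x = real_of_ereal (upper_average \<phi> x)" for x
  have [measurable]: "\<psi> \<in> borel_measurable M" unfolding \<psi>_def by measurable
  have up: "upper_average \<phi> x = ereal (\<psi> x)" for x
    using upper_average_bound[of \<phi> C x, OF bd] unfolding \<psi>_def by (cases "upper_average \<phi> x") auto
  have \<psi>bd: "\<bar>\<psi> x\<bar> \<le> C" for x
    using upper_average_bound[of \<phi> C x, OF bd] up[of x] by (auto simp: abs_le_iff)
  have C: "0 \<le> C" using \<psi>bd[of undefined] by linarith
  have inv: "\<psi> ((f ^^ m) x) = \<psi> x" for m x
    by (induction m arbitrary: x) (auto simp: \<psi>_def upper_average_invariant[of \<phi> C, OF bd])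
  \<comment> \<open>The deficit of the Birkhoff sum against the target
    \<open>n * (\<psi> x - \<delta>)\<close>; invariance of \<open>\<psi>\<close> makes it additive
    along orbits.\<close>
  define L where "L n x = real n * (\<psi> x - \<delta>) - birkhoff_sum f \<phi> n x" for n x
  have Ladd: "L (m + n) x = L m x + L n ((f ^^ m) x)" for m n x
    unfolding L_def birkhoff_sum_add inv by (simp add: algebra_simps)
  define G where "G m = {x. m \<ge> 1 \<and> L m x \<le> 0}" for m
  have [measurable]: "L m \<in> borel_measurable M" for m unfolding L_def by measurable
  have [measurable]: "G m \<in> sets M" for m
  proof -
    have "{x \<in> space M. m \<ge> 1 \<and> L m x \<le> 0} \<in> sets M" by measurable
    then show ?thesis by (simp add: G_def space_UNIV)
  qed
  have ex: "\<exists>m. x \<in> G m" for x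
  proof -
    have "ereal (\<psi> x - \<delta>) < upper_average \<phi> x" using \<delta> by (simp add: up)
    then have "\<exists>\<^sub>F n in sequentially. ereal (\<psi> x - \<delta>) < ereal (1 / real n * birkhoff_sum f \<phi> n x)"
      unfolding upper_average_def frequently_def not_less
      using Limsup_bounded[of "\<lambda>n. ereal (1 / real n * birkhoff_sum f \<phi> n x)" "ereal (\<psi> x - \<delta>)" sequentially]
      by (metis leD)
    then obtain n where n: "n \<ge> 1" "\<psi> x - \<delta> < 1 / real n * birkhoff_sum f \<phi> n x"
      unfolding frequently_sequentially by auto
    then have "L n x \<le> 0" by (simp add: L_def field_simps)
    then show ?thesis using n by (auto simp: G_def)
  qed
  define b where "b N = measure M (- (\<Union>m\<le>N. G m))" for N
  have b0: "b \<longlonglongrightarrow> 0" unfolding b_def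
    by (rule measure_never_tendsto_0) (use ex in auto)
  \<comment> \<open>One step raises the deficit by \<open>\<psi> x - \<delta> - \<phi> x\<close>,
    which is less than \<open>2 * C\<close>.\<close>
  define K where "K = 2 * C"
  have K0: "0 \<le> K" using C by (simp add: K_def)
  have key: "(\<integral>x. \<psi> x \<partial>M) - \<delta> - (\<integral>x. \<phi> x \<partial>M) \<le> K * b N" for N
  proof -
    define A where "A = - (\<Union>m\<le>N. G m)"
    have bA: "b N = measure M A" unfolding b_def A_def ..
    have [measurable]: "A \<in> sets M"
      unfolding A_def by (intro Compl_sets) auto
    have pw: "L n x \<le> K * (visits A n x + real N)" for n x
    proof (rule greedy_parsing[OF _ K0])
      show "L (Suc n) x \<le> K + L n (f x)" for n x
      proof -
        have "L (Suc n) x = L (Suc 0) x + L n (f x)" using Ladd[of "Suc 0" n x] by simp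
        moreover have "L (Suc 0) x \<le> K"
          using \<psi>bd[of x] bd[of x] \<delta> by (auto simp: L_def birkhoff_sum_def K_def abs_le_iff)
        ultimately show ?thesis by simp
      qed
      show "\<exists>m\<in>{1..N}. \<forall>n. L (m + n) x \<le> L n ((f ^^ m) x)" if x: "x \<notin> A" for x
      proof -
        obtain m where "m \<le> N" "x \<in> G m" using x unfolding A_def by blast
        then show ?thesis unfolding Ladd by (intro bexI[of _ m]) (auto simp: G_def)
      qed
    qed (simp add: L_def birkhoff_sum_def)
    have int\<psi>: "integrable M \<psi>" 
      by (intro integrable_const_bound[of _ C]) (auto simp: \<psi>bd)
    have intS: "integrable M (birkhoff_sum f \<phi> n)" for n
      by (intro integrable_const_bound[of _ "real n * C"]) (auto intro!: birkhoff_sum_bound bd)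
    \<comment> \<open>The final points cost \<open>K * N\<close> whatever \<open>n\<close> is, so
      their share vanishes after division by \<open>n\<close>.\<close>
    have "(\<integral>x. \<psi> x \<partial>M) - \<delta> - (\<integral>x. \<phi> x \<partial>M) - K * b N \<le> K * real N / real n" if n: "n \<ge> 1" for n
    proof -
      have "(\<integral>x. L n x \<partial>M) \<le> (\<integral>x. K * (visits A n x + real N) \<partial>M)"
        unfolding L_def
        by (intro integral_mono) (use pw in \<open>auto intro!: Bochner_Integration.integrable_diff Bochner_Integration.integrable_add
            integrable_mult_right int\<psi> intS visits_integrable simp: L_def\<close>)
      also have "(\<integral>x. L n x \<partial>M) = real n * ((\<integral>x. \<psi> x \<partial>M) - \<delta>) - real n * (\<integral>x. \<phi> x \<partial>M)"
        unfolding L_def using int\<psi> intS prob_space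
        by (simp add: integral_birkhoff_sum[OF _ bd])
      also have "(\<integral>x. K * (visits A n x + real N) \<partial>M) = K * (real n * b N + real N)"
        using visits_integrable[of A n] prob_space
        by (simp add: integral_visits bA)
      finally have "real n * ((\<integral>x. \<psi> x \<partial>M) - \<delta> - (\<integral>x. \<phi> x \<partial>M) - K * b N) \<le> K * real N"
        by (simp add: algebra_simps)
      then show ?thesis using n by (simp add: field_simps)
    qed
    moreover have "(\<lambda>n. K * real N / real n) \<longlonglongrightarrow> 0" by (rule lim_const_over_n)
    ultimately have "(\<integral>x. \<psi> x \<partial>M) - \<delta> - (\<integral>x. \<phi> x \<partial>M) - K * b N \<le> 0"
      by (intro LIMSEQ_le_const[of "\<lambda>n. K * real N / real n"]) (auto intro!: exI[of _ 1])
    then show ?thesis by simp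
  qed
  have "(\<lambda>N. K * b N) \<longlonglongrightarrow> K * 0" by (intro tendsto_intros b0)
  then have "(\<integral>x. \<psi> x \<partial>M) - \<delta> - (\<integral>x. \<phi> x \<partial>M) \<le> K * 0"
    by (rule LIMSEQ_le_const) (use key in auto)
  then show "(\<integral>x. real_of_ereal (upper_average \<phi> x) \<partial>M) \<le> (\<integral>x. \<phi> x \<partial>M) + \<delta>"
    by (simp add: \<psi>_def)
qed

text \<open>The integral bound applied to \<open>\<phi>\<close> and to \<open>- \<phi>\<close> shows
  that the nonnegative gap between upper and lower limit has integral at most 0, hence vanishes
  almost everywhere.\<close>

theorem birkhoff_ergodic:
  assumes [measurable]: "\<phi> \<in> borel_measurable M" and bd: "\<And>x. \<bar>\<phi> x\<bar> \<le> C"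
  shows "AE x in M. (\<lambda>n. 1 / real n * birkhoff_sum f \<phi> n x) \<longlonglongrightarrow> birkhoff_average f \<phi> x"
proof -
  define a where "a n y = 1 / real n * birkhoff_sum f \<phi> n y" for n y
  define \<psi> where "\<psi> x = real_of_ereal (upper_average \<phi> x)" for x
  define \<psi>' where "\<psi>' x = real_of_ereal (upper_average (\<lambda>x. - \<phi> x) x)" for x
  have bd': "\<bar>- \<phi> x\<bar> \<le> C" for x using bd by simp
  have [measurable]: "\<psi> \<in> borel_measurable M" "\<psi>' \<in> borel_measurable M"
    unfolding \<psi>_def \<psi>'_def by measurable
  have up: "upper_average \<phi> x = ereal (\<psi> x)" for x
    using upper_average_bound[of \<phi> C x, OF bd] unfolding \<psi>_def by (cases "upper_average \<phi> x") auto
  have up': "upper_average (\<lambda>x. - \<phi> x) x = ereal (\<psi>' x)" for x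
    using upper_average_bound[of "\<lambda>x. - \<phi> x" C x, OF bd'] unfolding \<psi>'_def
    by (cases "upper_average (\<lambda>x. - \<phi> x) x") auto
  have \<psi>bd: "\<bar>\<psi> x\<bar> \<le> C" "\<bar>\<psi>' x\<bar> \<le> C" for x
    using upper_average_bound[of \<phi> C x, OF bd] up[of x]
      upper_average_bound[of "\<lambda>x. - \<phi> x" C x, OF bd'] up'[of x] by (auto simp: abs_le_iff)
  have int: "integrable M \<psi>" "integrable M \<psi>'"
    by (auto intro!: integrable_const_bound[of _ C] simp: \<psi>bd)
  have low: "liminf (\<lambda>n. ereal (a n x)) = ereal (- \<psi>' x)" for x
  proof -
    have "- liminf (\<lambda>n. ereal (a n x)) = limsup (\<lambda>n. - ereal (a n x))"
      by (rule ereal_Limsup_uminus[symmetric])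
    also have "(\<lambda>n. - ereal (a n x)) = (\<lambda>n. ereal (1 / real n * birkhoff_sum f (\<lambda>x. - \<phi> x) n x))"
      by (simp add: a_def birkhoff_sum_def sum_negf)
    also have "limsup \<dots> = ereal (\<psi>' x)" using up'[of x] by (simp add: upper_average_def)
    finally show ?thesis by (metis ereal_uminus_uminus uminus_ereal.simps(1))
  qed
  have ge: "0 \<le> \<psi> x + \<psi>' x" for x
  proof -
    have "liminf (\<lambda>n. ereal (a n x)) \<le> limsup (\<lambda>n. ereal (a n x))" by (intro Liminf_le_Limsup) auto
    then show ?thesis using low[of x] up[of x] by (simp add: upper_average_def a_def)
  qed
  have "(\<integral>x. \<psi> x \<partial>M) \<le> (\<integral>x. \<phi> x \<partial>M)"
    unfolding \<psi>_def by (rule integral_upper_average_le[OF _ bd]) measurable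
  moreover have "(\<integral>x. \<psi>' x \<partial>M) \<le> (\<integral>x. - \<phi> x \<partial>M)"
    unfolding \<psi>'_def by (rule integral_upper_average_le[OF _ bd']) measurable
  ultimately have "(\<integral>x. \<psi> x + \<psi>' x \<partial>M) \<le> 0"
    using int by simp
  moreover have "0 \<le> (\<integral>x. \<psi> x + \<psi>' x \<partial>M)" using ge by (intro integral_nonneg_AE) auto
  ultimately have "(\<integral>x. \<psi> x + \<psi>' x \<partial>M) = 0" by simp
  then have "AE x in M. \<psi> x + \<psi>' x = 0"
    using int ge by (subst (asm) integral_nonneg_eq_0_iff_AE) auto
  then show ?thesis
  proof eventually_elim
    case (elim x)
    then have eq: "- \<psi>' x = \<psi> x" by simp
    have "(\<lambda>n. ereal (a n x)) \<longlonglongrightarrow> ereal (\<psi> x)"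
      by (subst tendsto_iff_Liminf_eq_Limsup)
        (use low[of x] up[of x] eq in \<open>auto simp: upper_average_def a_def\<close>)
    then have "(\<lambda>n. a n x) \<longlonglongrightarrow> \<psi> x" by simp
    then show ?case unfolding a_def birkhoff_average_def by (metis limI)
  qed
qed

section \<open>Consequences of ergodicity\<close>

text \<open>A superlevel set \<open>A\<close> of \<open>g\<close> only contains its preimage, while
  \<open>ergodic\<close> speaks of sets equal to their preimage. The intersection of all iterated
  preimages of \<open>A\<close> is such a set, and it has the measure of \<open>A\<close> because
  the preimages decrease and all have that measure. This one-sided form fits local entropy, see
  \<open>pressure_at_0_image_le\<close>.\<close>

lemma ergodic_AE_const:
  fixes g :: "'a \<Rightarrow> ereal"
  assumes erg: "ergodic M f" and [measurable]: "g \<in> borel_measurable M" and le: "\<And>x. g (f x) \<le> g x"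
  shows "AE x in M. g x = esssup M g"
proof -
  have zero_one: "measure M {x. z < g x} = 0 \<or> measure M {x. z < g x} = 1" for z
  proof -
    define A where "A = {x. z < g x}"
    define B where "B = (\<Inter>n. (f ^^ n) -` A)"
    have "{x \<in> space M. z < g x} \<in> sets M" by measurable
    then have A: "A \<in> sets M" by (simp add: A_def space_UNIV)
    have dec: "(f ^^ Suc n) -` A \<subseteq> (f ^^ n) -` A" for n
      using le by (auto simp: A_def elim!: order.strict_trans2)
    have decs: "decseq (\<lambda>n. (f ^^ n) -` A)" by (rule decseq_SucI) (rule dec)
    have "f -` B = B"
    proof (intro equalityI subsetI)
      fix x assume "x \<in> f -` B"
      then have "x \<in> (f ^^ Suc n) -` A" for n
        by (auto simp: B_def funpow_swap1 simp del: funpow.simps) (auto simp: funpow_swap1)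
      then show "x \<in> B" using dec by (auto simp: B_def simp del: funpow.simps)
    next
      fix x assume "x \<in> B"
      then have "x \<in> (f ^^ Suc n) -` A" for n unfolding B_def by blast
      then show "x \<in> f -` B" by (auto simp: B_def funpow_swap1)
    qed
    moreover have "B \<in> sets M" unfolding B_def using vimage_iterate_sets[OF A] by auto
    ultimately have "measure M B = 0 \<or> measure M B = 1" using erg unfolding ergodic_def by blast
    moreover have "(\<lambda>n. measure M ((f ^^ n) -` A)) \<longlonglongrightarrow> measure M B"
      unfolding B_def using vimage_iterate_sets[OF A] decs by (intro finite_Lim_measure_decseq) auto
    then have "measure M B = measure M A"
      by (simp add: measure_vimage_iterate[OF A] LIMSEQ_const_iff)
    ultimately show ?thesis by (simp add: A_def)
  qed
  \<comment> \<open>Positive measure means measure 1 by the zero-one law; a sequence of such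
    \<open>z\<close> then reaches the essential supremum from below.\<close>
  have "AE x in M. z < g x" if "z < esssup M g" for z
  proof -
    have "0 < emeasure M {x \<in> space M. z < g x}" by (rule esssup_pos_measure) (use that in auto)
    then have "measure M {x. z < g x} = 1"
      using zero_one[of z] by (auto simp: space_UNIV emeasure_eq_measure)
    then show ?thesis by (rule AE_prob_1[of "{x. z < g x}", simplified])
  qed note above = this
  have "AE x in M. esssup M g \<le> g x"
  proof (cases "esssup M g = -\<infinity>")
    case False
    then have "-\<infinity> < esssup M g" by (simp add: less_le)
    from approx_from_below_dense_linorder[OF this]
    obtain u where u: "\<And>n. u n < esssup M g" "u \<longlonglongrightarrow> esssup M g" by blast
    have "AE x in M. \<forall>n. u n < g x" by (simp add: AE_all_countable above u)
    then show ?thesis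
      by eventually_elim (meson LIMSEQ_le_const2 less_imp_le u(2))
  qed auto
  moreover have "AE x in M. g x \<le> esssup M g" by (rule esssup_AE)
  ultimately show ?thesis by eventually_elim auto
qed

lemma ergodic_birkhoff_average:
  assumes erg: "ergodic M f" and [measurable]: "\<phi> \<in> borel_measurable M" and bd: "\<And>x. \<bar>\<phi> x\<bar> \<le> C"
  shows "AE x in M. birkhoff_average f \<phi> x = (\<integral>x. \<phi> x \<partial>M)"
proof -
  have lims: "AE x in M. (\<lambda>n. 1 / real n * birkhoff_sum f \<phi> n x) \<longlonglongrightarrow> birkhoff_average f \<phi> x"
    by (rule birkhoff_ergodic[OF _ bd]) measurable
  have [measurable]: "birkhoff_average f \<phi> \<in> borel_measurable M"
    unfolding birkhoff_average_def by measurable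
  have "AE x in M. upper_average \<phi> x = esssup M (upper_average \<phi>)"
    by (rule ergodic_AE_const[OF erg]) (auto simp: upper_average_invariant[of \<phi> C, OF bd])
  with lims have const: "AE x in M. ereal (birkhoff_average f \<phi> x) = esssup M (upper_average \<phi>)"
  proof eventually_elim
    case (elim x)
    have "upper_average \<phi> x = ereal (birkhoff_average f \<phi> x)"
      unfolding upper_average_def by (intro lim_imp_Limsup) (use elim in auto)
    then show ?case using elim by simp
  qed
  define c where "c = real_of_ereal (esssup M (upper_average \<phi>))"
  have c: "AE x in M. birkhoff_average f \<phi> x = c"
    using const by eventually_elim (metis c_def real_of_ereal.simps(1))
  \<comment> \<open>The constant is identified through the integrals of the averages, which equal
    the integral of \<open>\<phi>\<close> for every n \<ge> 1.\<close>
  have "(\<lambda>n. \<integral>x. 1 / real n * birkhoff_sum f \<phi> n x \<partial>M) \<longlonglongrightarrow> (\<integral>x. birkhoff_average f \<phi> x \<partial>M)"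
    by (rule integral_dominated_convergence[where w = "\<lambda>_. C"])
      (use lims average_bound[of \<phi> C, OF bd] in auto)
  also have "(\<integral>x. birkhoff_average f \<phi> x \<partial>M) = (\<integral>x. c \<partial>M)" by (intro integral_cong_AE c) auto
  also have "\<dots> = c" using prob_space by simp
  finally have "(\<lambda>n. \<integral>x. 1 / real n * birkhoff_sum f \<phi> n x \<partial>M) \<longlonglongrightarrow> c" .
  moreover have "(\<lambda>n. \<integral>x. 1 / real n * birkhoff_sum f \<phi> n x \<partial>M) \<longlonglongrightarrow> (\<integral>x. \<phi> x \<partial>M)"
    by (rule tendsto_eventually, rule eventually_sequentiallyI[of 1])
      (simp add: integral_birkhoff_sum[OF _ bd])
  ultimately have "c = (\<integral>x. \<phi> x \<partial>M)" by (rule LIMSEQ_unique)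
  then show ?thesis using c by simp
qed

end

section \<open>Entropy of itineraries\<close>

text \<open>Sum the inequality ln t \<le> t - 1 at t = q / p. The mass of \<open>q\<close> may be
  smaller than that of \<open>p\<close>, as happens for code weights.\<close>

lemma gibbs_inequality:
  fixes p q :: "'b \<Rightarrow> real"
  assumes "finite W" and p: "\<And>w. w \<in> W \<Longrightarrow> 0 \<le> p w" and q: "\<And>w. w \<in> W \<Longrightarrow> 0 \<le> q w"
    and pq: "\<And>w. w \<in> W \<Longrightarrow> 0 < p w \<Longrightarrow> 0 < q w"
    and sums: "(\<Sum>w\<in>W. q w) \<le> (\<Sum>w\<in>W. p w)"
  shows "- (\<Sum>w\<in>W. p w * ln (p w)) \<le> (\<Sum>w\<in>W. p w * - ln (q w))"
proof -
  have "p w * ln (q w) - p w * ln (p w) \<le> q w - p w" if w: "w \<in> W" for w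
  proof (cases "p w = 0")
    case False
    then have pos: "0 < p w" "0 < q w" using p[OF w] pq[OF w] by auto
    then have "p w * ln (q w) - p w * ln (p w) = p w * ln (q w / p w)"
      by (simp add: ln_div algebra_simps)
    also have "\<dots> \<le> p w * (q w / p w - 1)"
      using pos by (intro mult_left_mono ln_le_minus_one) auto
    also have "\<dots> = q w - p w" using pos by (simp add: field_simps)
    finally show ?thesis .
  qed (use q[OF w] in simp)
  then have "(\<Sum>w\<in>W. p w * ln (q w) - p w * ln (p w)) \<le> (\<Sum>w\<in>W. q w - p w)"
    by (rule sum_mono)
  then show ?thesis using sums by (simp add: sum_subtractf sum_negf)
qed

locale pmp_partition = pmp_system +
  fixes P :: "'a set set"
  assumes finite_P: "finite P" and P_sets: "P \<subseteq> sets M" and P_partition: "partition_on UNIV P"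
begin

definition cell :: "'a \<Rightarrow> 'a set" where
  "cell x = (THE A. A \<in> P \<and> x \<in> A)"

lemma cell: "cell x \<in> P" "x \<in> cell x"
proof -
  have "\<exists>!A. A \<in> P \<and> x \<in> A"
    using P_partition unfolding partition_on_def disjoint_def by blast
  from theI'[OF this] show "cell x \<in> P" "x \<in> cell x" by (auto simp: cell_def)
qed

lemma cell_eq: "A \<in> P \<Longrightarrow> x \<in> A \<Longrightarrow> cell x = A"
  using P_partition cell[of x] unfolding partition_on_def disjoint_def by blast

lemma P_nonempty: "P \<noteq> {}"
  using cell(1) by auto

definition itinerary :: "nat \<Rightarrow> 'a \<Rightarrow> 'a set list" where
  "itinerary n x = map (\<lambda>i. cell ((f ^^ i) x)) [0..<n]"

lemma length_itinerary [simp]: "length (itinerary n x) = n"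
  by (simp add: itinerary_def)

lemma nth_itinerary [simp]: "i < n \<Longrightarrow> itinerary n x ! i = cell ((f ^^ i) x)"
  by (simp add: itinerary_def)

lemma itinerary_words: "itinerary n x \<in> words P n"
  by (auto simp: itinerary_def cell)

lemma itinerary_add: "itinerary (m + n) x = itinerary m x @ itinerary n ((f ^^ m) x)"
  by (rule nth_equalityI) (auto simp: nth_append funpow_add[symmetric, THEN fun_cong, simplified])

lemma finite_words: "finite (words P n)"
  using finite_lists_length_eq[OF finite_P] by simp

definition cylinder :: "'a set list \<Rightarrow> 'a set" where
  "cylinder w = {x. itinerary (length w) x = w}"

lemma cylinder_append: "cylinder (u @ v) = cylinder u \<inter> (f ^^ length u) -` cylinder v"
  by (auto simp: cylinder_def itinerary_add)

lemma cylinder_sets: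
  assumes "w \<in> words P n"
  shows "cylinder w \<in> sets M"
proof -
  have "cylinder w = space M \<inter> (\<Inter>i\<in>{..<length w}. (f ^^ i) -` (w ! i))"
  proof (intro equalityI subsetI)
    fix x assume "x \<in> cylinder w"
    then have "itinerary (length w) x = w" by (simp add: cylinder_def)
    then have "cell ((f ^^ i) x) = w ! i" if "i < length w" for i using that by (metis nth_itinerary)
    then show "x \<in> space M \<inter> (\<Inter>i\<in>{..<length w}. (f ^^ i) -` (w ! i))"
      using cell(2) by (auto simp: space_UNIV)
  next
    fix x assume x: "x \<in> space M \<inter> (\<Inter>i\<in>{..<length w}. (f ^^ i) -` (w ! i))"
    have "itinerary (length w) x = w"
    proof (rule nth_equalityI)
      fix i assume "i < length (itinerary (length w) x)"
      moreover from this have "w ! i \<in> P" using assms by (auto dest: nth_mem)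
      ultimately show "itinerary (length w) x ! i = w ! i" using x by (auto intro!: cell_eq)
    qed simp
    then show "x \<in> cylinder w" by (simp add: cylinder_def)
  qed
  moreover have "(f ^^ i) -` (w ! i) \<in> sets M" if "i < length w" for i
    using assms that P_sets by (intro vimage_iterate_sets) (auto simp: subset_iff in_set_conv_nth)
  moreover have "space M \<inter> (\<Inter>i\<in>{..<length w}. (f ^^ i) -` (w ! i)) \<in> sets M" if "w \<noteq> []"
    using that calculation(2) by (intro sets.Int sets.top sets.finite_INT) auto
  ultimately show ?thesis by (cases "w = []") auto
qed

lemma sum_measure_cylinder:
  assumes B: "B \<in> sets M"
  shows "(\<Sum>w\<in>words P n. measure M (cylinder w \<inter> B)) = measure M B"
proof -
  have "measure M (\<Union>w\<in>words P n. cylinder w \<inter> B) = (\<Sum>w\<in>words P n. measure M (cylinder w \<inter> B))"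
    by (rule finite_measure_finite_Union)
      (use cylinder_sets B in \<open>auto simp: finite_words disjoint_family_on_def cylinder_def\<close>)
  moreover have "(\<Union>w\<in>words P n. cylinder w \<inter> B) = B"
    using itinerary_words[of n] by (auto simp: cylinder_def)
  ultimately show ?thesis by simp
qed

abbreviation word_prob :: "'a set list \<Rightarrow> real" where
  "word_prob w \<equiv> measure M (cylinder w)"

lemma sum_word_prob: "(\<Sum>w\<in>words P n. word_prob w) = 1"
  using sum_measure_cylinder[OF sets.top, of n] prob_space by (simp add: space_UNIV)

lemma sum_word_prob_prefix:
  assumes "u \<in> words P m"
  shows "(\<Sum>v\<in>words P n. word_prob (u @ v)) = word_prob u"
proof -
  have eq: "cylinder u = (\<Union>v\<in>words P n. cylinder (u @ v))"
    using itinerary_words[of n] by (auto simp: cylinder_def itinerary_add)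
  have "measure M (\<Union>v\<in>words P n. cylinder (u @ v)) = (\<Sum>v\<in>words P n. word_prob (u @ v))"
  proof (rule finite_measure_finite_Union)
    show "(\<lambda>v. cylinder (u @ v)) ` words P n \<subseteq> sets M"
      using assms by (auto intro!: cylinder_sets[of _ "m + n"])
  qed (auto simp: finite_words[simplified] disjoint_family_on_def cylinder_def)
  then show ?thesis using eq by simp
qed

text \<open>Here invariance of the measure enters: letters read from time \<open>m\<close> on have
  the law of those read from time 0.\<close>

lemma sum_word_prob_suffix:
  assumes v: "v \<in> words P n"
  shows "(\<Sum>u\<in>words P m. word_prob (u @ v)) = word_prob v"
proof -
  have "(\<Sum>u\<in>words P m. word_prob (u @ v)) =
      (\<Sum>u\<in>words P m. measure M (cylinder u \<inter> (f ^^ m) -` cylinder v))"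
    by (intro sum.cong refl) (auto simp: cylinder_append)
  also have "\<dots> = measure M ((f ^^ m) -` cylinder v)"
    by (intro sum_measure_cylinder vimage_iterate_sets cylinder_sets[OF v])
  also have "\<dots> = word_prob v" by (intro measure_vimage_iterate cylinder_sets[OF v])
  finally show ?thesis .
qed

text \<open>An element of the join arises from a choice of one set in each pulled back partition. If
  the chosen sets share a point \<open>x\<close>, each is the preimage of
  \<open>cell ((f ^^ i) x)\<close>, so the choice is forced and the intersection is the cylinder of
  the itinerary of \<open>x\<close>.\<close>

lemma iterated_join_eq: "iterated_join f P n = cylinder ` words P n - {{}}"
proof -
  define Q where "Q i = ((-`) (f ^^ i)) ` P - {{}}" for i
  have cyl: "(\<Inter>R\<in>Q ` {..<n}. F R) = cylinder (itinerary n x)"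
    if F: "\<And>R. R \<in> Q ` {..<n} \<Longrightarrow> F R \<in> R \<and> x \<in> F R" for F x
  proof (intro equalityI subsetI)
    have FQ: "F (Q i) = (f ^^ i) -` cell ((f ^^ i) x)" if "i < n" for i
    proof -
      have "F (Q i) \<in> Q i" "x \<in> F (Q i)" using F that by auto
      then obtain A where "A \<in> P" "F (Q i) = (f ^^ i) -` A" by (auto simp: Q_def)
      then show ?thesis using \<open>x \<in> F (Q i)\<close> cell_eq[of A "(f ^^ i) x"] by auto
    qed
    {
      fix y assume "y \<in> (\<Inter>R\<in>Q ` {..<n}. F R)"
      then have "(f ^^ i) y \<in> cell ((f ^^ i) x)" if "i < n" for i using FQ[OF that] that by auto
      then show "y \<in> cylinder (itinerary n x)"
        using cell_eq[OF cell(1)] by (simp add: cylinder_def list_eq_iff_nth_eq)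
    next
      fix y assume "y \<in> cylinder (itinerary n x)"
      then have "itinerary n y = itinerary n x" by (simp add: cylinder_def)
      then have "cell ((f ^^ i) y) = cell ((f ^^ i) x)" if "i < n" for i
        using that by (metis nth_itinerary)
      then have "(f ^^ i) y \<in> cell ((f ^^ i) x)" if "i < n" for i
        using that cell(2)[of "(f ^^ i) y"] by simp
      then show "y \<in> (\<Inter>R\<in>Q ` {..<n}. F R)" using FQ by auto
    }
  qed
  have join: "iterated_join f P n = (\<Union>F\<in>(\<Pi> R\<in>Q ` {..<n}. R). {\<Inter> (F ` Q ` {..<n})}) - {{}}"
    unfolding iterated_join_def common_refinement Q_def ..
  show ?thesis
  proof (intro equalityI subsetI)
    fix X assume "X \<in> iterated_join f P n"
    then obtain F where F: "F \<in> (\<Pi> R\<in>Q ` {..<n}. R)" "X = \<Inter> (F ` Q ` {..<n})" "X \<noteq> {}"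
      unfolding join by auto
    then obtain x where x: "x \<in> X" by auto
    have "X = cylinder (itinerary n x)" unfolding F(2)
      by (rule cyl) (use F x in \<open>auto simp: Pi_iff\<close>)
    then show "X \<in> cylinder ` words P n - {{}}" using F(3) itinerary_words[of n x] by blast
  next
    fix X assume X: "X \<in> cylinder ` words P n - {{}}"
    then obtain w x where "w \<in> words P n" "X = cylinder w" "x \<in> X" by auto
    then have Xx: "X = cylinder (itinerary n x)" by (auto simp: cylinder_def)
    \<comment> \<open>The choice is indexed by the partition \<open>R\<close> and not by the time
      \<open>i\<close>, since different times may give the same pulled back partition.\<close>
    define F where "F R = (SOME Y. Y \<in> R \<and> x \<in> Y)" for R
    have F: "F R \<in> R \<and> x \<in> F R" if R: "R \<in> Q ` {..<n}" for R
    proof -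
      obtain i where "i < n" "R = Q i" using R by blast
      then have "(f ^^ i) -` cell ((f ^^ i) x) \<in> R \<and> x \<in> (f ^^ i) -` cell ((f ^^ i) x)"
        using cell by (auto simp: Q_def)
      then show ?thesis unfolding F_def by (rule someI)
    qed
    then have "X = (\<Inter>R\<in>Q ` {..<n}. F R)" using Xx cyl[of F x] by simp
    then show "X \<in> iterated_join f P n" unfolding join using F X by (auto simp: Pi_iff)
  qed
qed

definition join_entropy :: "nat \<Rightarrow> real" where
  "join_entropy n = partition_entropy M (iterated_join f P n)"

text \<open>\<open>cylinder\<close> is injective on words whose cylinder is nonempty, and the other
  words add 0 because \<open>0 * ln 0 = 0\<close>. Unlike the join, the set of words factors under
  concatenation.\<close>

lemma join_entropy_eq: "join_entropy n = - (\<Sum>w\<in>words P n. word_prob w * ln (word_prob w))"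
proof -
  define W where "W = {w \<in> words P n. cylinder w \<noteq> {}}"
  have img: "cylinder ` words P n - {{}} = cylinder ` W" by (auto simp: W_def)
  have inj: "inj_on cylinder W"
  proof (rule inj_onI)
    fix u v assume "u \<in> W" "v \<in> W" and eq: "cylinder u = cylinder v"
    then obtain x where "x \<in> cylinder u" "length u = n" "length v = n" by (auto simp: W_def)
    moreover from this have "x \<in> cylinder v" using eq by simp
    ultimately have "itinerary n x = u" "itinerary n x = v" by (auto simp: cylinder_def)
    then show "u = v" by simp
  qed
  have "(\<Sum>A\<in>cylinder ` W. measure M A * ln (measure M A)) = (\<Sum>w\<in>W. word_prob w * ln (word_prob w))"
    by (simp add: sum.reindex[OF inj])
  also have "\<dots> = (\<Sum>w\<in>words P n. word_prob w * ln (word_prob w))"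
    by (intro sum.mono_neutral_left finite_words) (auto simp: W_def)
  finally show ?thesis
    unfolding join_entropy_def partition_entropy_def iterated_join_eq img by simp
qed

lemma join_entropy_nonneg: "0 \<le> join_entropy n"
proof -
  have "word_prob w * ln (word_prob w) \<le> 0" for w
  proof (cases "word_prob w = 0")
    case False
    then have "0 < word_prob w" by (simp add: zero_less_measure_iff)
    then show ?thesis by (intro mult_nonneg_nonpos) (auto simp: ln_le_zero_iff)
  qed simp
  then show ?thesis unfolding join_entropy_eq by (simp add: sum_nonpos)
qed

text \<open>Measurability, integrability and the integral of functions of the itinerary all reduce
  to this finite combination of indicators.\<close>

lemma itinerary_expansion:
  "(G (itinerary n x) :: real) = (\<Sum>w\<in>words P n. G w * indicator (cylinder w) x)"
proof -
  have "(\<Sum>w\<in>words P n. G w * indicator (cylinder w) x) = (\<Sum>w\<in>{itinerary n x}. G w * indicator (cylinder w) x)"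
    using itinerary_words[of n x]
    by (intro sum.mono_neutral_right finite_words) (auto simp: cylinder_def)
  then show ?thesis by (simp add: cylinder_def)
qed

lemma itinerary_measurable: "(\<lambda>x. G (itinerary n x) :: real) \<in> borel_measurable M"
  unfolding itinerary_expansion[of G]
  by (intro borel_measurable_sum borel_measurable_times borel_measurable_const borel_measurable_indicator cylinder_sets)

lemma integrable_itinerary: "integrable M (\<lambda>x. G (itinerary n x) :: real)"
  unfolding itinerary_expansion[of G]
  by (intro Bochner_Integration.integrable_sum integrable_mult_right integrable_real_indicator cylinder_sets)
    (auto simp: emeasure_eq_measure)

lemma integral_itinerary: "(\<integral>x. G (itinerary n x) \<partial>M) = (\<Sum>w\<in>words P n. word_prob w * (G w :: real))"
proof -
  have "(\<integral>x. G (itinerary n x) \<partial>M) = (\<Sum>w\<in>words P n. \<integral>x. G w * indicator (cylinder w) x \<partial>M)"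
    unfolding itinerary_expansion[of G]
    by (intro Bochner_Integration.integral_sum integrable_mult_right integrable_real_indicator cylinder_sets)
      (auto simp: emeasure_eq_measure)
  then show ?thesis by (simp add: space_UNIV mult.commute)
qed

text \<open>Source coding: a \<open>q\<close> of mass at most 1 is a code in the sense of Kraft,
  \<open>- ln (q w)\<close> is its code length, and the mean length of a code is at least the
  entropy.\<close>

lemma join_entropy_le_integral:
  assumes q: "\<And>w. w \<in> words P n \<Longrightarrow> 0 \<le> q w" and pq: "\<And>w. w \<in> words P n \<Longrightarrow> 0 < word_prob w \<Longrightarrow> 0 < q w"
    and sum: "(\<Sum>w\<in>words P n. q w) \<le> 1"
  shows "join_entropy n \<le> (\<integral>x. - ln (q (itinerary n x)) \<partial>M)"
  unfolding join_entropy_eq integral_itinerary[of "\<lambda>w. - ln (q w)"]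
  by (rule gibbs_inequality) (use assms in \<open>auto simp: finite_words[simplified] sum_word_prob\<close>)

lemma integral_minus_ln_word_prob:
  "(\<integral>x. - ln (word_prob (itinerary n x)) \<partial>M) = join_entropy n"
  unfolding join_entropy_eq integral_itinerary[of "\<lambda>w. - ln (word_prob w)"] by (simp add: sum_negf)

text \<open>With \<open>ln 0 = 0\<close>, logarithms of words of probability 0 would falsify product
  formulas and comparisons. There are finitely many words of each length, so these words are met
  only on a null set.\<close>

lemma AE_word_prob_pos: "AE x in M. \<forall>n. 0 < word_prob (itinerary n x)"
proof -
  have "AE x in M. 0 < word_prob (itinerary n x)" for n
  proof -
    have "AE x in M. \<forall>w\<in>words P n. word_prob w = 0 \<longrightarrow> x \<notin> cylinder w"
    proof (rule AE_finite_allI[OF finite_words])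
      fix w assume "w \<in> words P n"
      then show "AE x in M. word_prob w = 0 \<longrightarrow> x \<notin> cylinder w"
        using cylinder_sets[of w n]
        by (cases "word_prob w = 0") (auto intro!: AE_not_in simp: null_sets_def emeasure_eq_measure)
    qed
    then show ?thesis
    proof eventually_elim
      case (elim x)
      then have "word_prob (itinerary n x) \<noteq> 0"
        using itinerary_words[of n x] by (auto simp: cylinder_def)
      then show ?case by (simp add: zero_less_measure_iff)
    qed
  qed
  then show ?thesis by (simp add: AE_all_countable)
qed

text \<open>Take the code that treats the first \<open>m\<close> and the last \<open>n\<close>
  letters as independent. By invariance its mean length is the sum of the two entropies.\<close>

lemma join_entropy_subadditive: "join_entropy (m + n) \<le> join_entropy m + join_entropy n"
proof -
  define q where "q w = word_prob (take m w) * word_prob (drop m w)" for w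
  have le: "word_prob (u @ v) \<le> word_prob u" "word_prob (u @ v) \<le> word_prob v"
    if "u \<in> words P m" "v \<in> words P n" for u v
    using sum_word_prob_prefix[OF that(1), of n] sum_word_prob_suffix[OF that(2), of m] that
      member_le_sum[of v "words P n" "\<lambda>v. word_prob (u @ v)"]
      member_le_sum[of u "words P m" "\<lambda>u. word_prob (u @ v)"] finite_words
    by auto
  have "join_entropy (m + n) \<le> (\<integral>x. - ln (q (itinerary (m + n) x)) \<partial>M)"
  proof (rule join_entropy_le_integral)
    show "0 < q w" if w: "w \<in> words P (m + n)" "0 < word_prob w" for w
    proof -
      have "take m w \<in> words P m" "drop m w \<in> words P n"
        using w by (auto dest: in_set_takeD in_set_dropD)
      from le[OF this] w(2) show ?thesis by (simp add: q_def)
    qed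
    have "(\<Sum>w\<in>words P (m + n). q w) = (\<Sum>u\<in>words P m. \<Sum>v\<in>words P n. word_prob u * word_prob v)"
      unfolding sum_words_append[OF finite_P] by (intro sum.cong refl) (auto simp: q_def)
    also have "\<dots> = 1" by (simp only: sum_distrib_left[symmetric] sum_word_prob) (simp add: sum_word_prob)
    finally show "(\<Sum>w\<in>words P (m + n). q w) \<le> 1" by simp
  qed (auto simp: q_def)
  also have "\<dots> = (\<integral>x. - ln (word_prob (itinerary m x)) + - ln (word_prob (itinerary n ((f ^^ m) x))) \<partial>M)"
  proof (rule integral_cong_AE)
    show "AE x in M. - ln (q (itinerary (m + n) x)) =
        - ln (word_prob (itinerary m x)) + - ln (word_prob (itinerary n ((f ^^ m) x)))"
      using AE_word_prob_pos AE_iterate[OF AE_word_prob_pos]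
    proof eventually_elim
      case (elim x)
      then have "0 < word_prob (itinerary m x)" "0 < word_prob (itinerary n ((f ^^ m) x))" by auto
      then show ?case by (simp add: q_def itinerary_add ln_mult)
    qed
    have "(\<lambda>x. - ln (word_prob (itinerary n x))) \<in> borel_measurable M" for n
      using itinerary_measurable[of "\<lambda>w. - ln (word_prob w)"] .
    then show "(\<lambda>x. - ln (word_prob (itinerary m x)) + - ln (word_prob (itinerary n ((f ^^ m) x)))) \<in> borel_measurable M"
      by (intro borel_measurable_add) (auto intro: measurable_compose[OF measurable_iterate])
  qed (rule itinerary_measurable)
  also have "\<dots> = (\<integral>x. - ln (word_prob (itinerary m x)) \<partial>M) + (\<integral>x. - ln (word_prob (itinerary n ((f ^^ m) x))) \<partial>M)"
  proof (rule Bochner_Integration.integral_add)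
    show "integrable M (\<lambda>x. - ln (word_prob (itinerary m x)))"
      using integrable_itinerary[of "\<lambda>w. - ln (word_prob w)"] .
    have "integrable (distr M M (f ^^ m)) (\<lambda>x. - ln (word_prob (itinerary n x)))"
      unfolding distr_iterate using integrable_itinerary[of "\<lambda>w. - ln (word_prob w)"] .
    then show "integrable M (\<lambda>x. - ln (word_prob (itinerary n ((f ^^ m) x))))"
      by (rule integrable_distr[OF measurable_iterate])
  qed
  also have "(\<integral>x. - ln (word_prob (itinerary n ((f ^^ m) x))) \<partial>M) = (\<integral>x. - ln (word_prob (itinerary n x)) \<partial>M)"
    using itinerary_measurable[of "\<lambda>w. - ln (word_prob w)"] by (rule integral_iterate)
  finally show ?thesis unfolding integral_minus_ln_word_prob .
qed

text \<open>By Fekete's lemma the \<open>lim\<close> in the definition is a genuine limit.\<close>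

lemma join_entropy_LIMSEQ:
  "(\<lambda>n. join_entropy n / real n) \<longlonglongrightarrow> entropy_wrt_partition M f P"
  using fekete_subadditive[OF join_entropy_subadditive join_entropy_nonneg]
  unfolding entropy_wrt_partition_def join_entropy_def[symmetric] convergent_LIMSEQ_iff .

end

section \<open>Bowen balls and pressure\<close>

lemma bowen_ball_iff:
  "0 < n \<Longrightarrow> y \<in> bowen_ball f n x \<epsilon> \<longleftrightarrow> (\<forall>i<n. dist ((f ^^ i) x) ((f ^^ i) y) < \<epsilon>)"
  unfolding bowen_ball_def bowen_dist_def by (auto simp: Max_less_iff lessThan_empty_iff)

lemma bowen_ball_mono: "\<epsilon> \<le> \<epsilon>' \<Longrightarrow> bowen_ball f n x \<epsilon> \<subseteq> bowen_ball f n x \<epsilon>'"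
  by (auto simp: bowen_ball_def)

lemma bowen_ball_center: "0 < n \<Longrightarrow> 0 < \<epsilon> \<Longrightarrow> x \<in> bowen_ball f n x \<epsilon>"
  by (simp add: bowen_ball_iff)

lemma bowen_ball_sym: "0 < n \<Longrightarrow> y \<in> bowen_ball f n x \<epsilon> \<Longrightarrow> x \<in> bowen_ball f n y \<epsilon>"
  by (simp add: bowen_ball_iff dist_commute)

lemma bowen_ball_triangle:
  assumes "0 < n" "y \<in> bowen_ball f n x \<epsilon>" "z \<in> bowen_ball f n y \<delta>"
  shows "z \<in> bowen_ball f n x (\<epsilon> + \<delta>)"
  unfolding bowen_ball_iff[OF assms(1)]
proof (intro allI impI)
  fix i assume "i < n"
  then have "dist ((f ^^ i) x) ((f ^^ i) y) + dist ((f ^^ i) y) ((f ^^ i) z) < \<epsilon> + \<delta>"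
    using assms by (auto simp: bowen_ball_iff intro!: add_strict_mono)
  then show "dist ((f ^^ i) x) ((f ^^ i) z) < \<epsilon> + \<delta>"
    using dist_triangle[of "(f ^^ i) x" "(f ^^ i) z" "(f ^^ i) y"] by linarith
qed

text \<open>Translates between the extended-real terms of the lower limit and bounds on measures of
  balls. For \<open>p = 0\<close> both sides are false, because \<open>minus_ln 0\<close> is
  infinite.\<close>

lemma pressure_term_less_iff:
  assumes "0 < n" "0 \<le> p"
  shows "ereal (1 / real n) * (minus_ln p + ereal S) < ereal s \<longleftrightarrow> exp (S - real n * s) < p"
proof (cases "p = 0")
  case False
  then have p: "0 < p" using assms by simp
  have "ereal (1 / real n) * (minus_ln p + ereal S) < ereal s \<longleftrightarrow> S - real n * s < ln p"
    using assms False by (simp add: minus_ln_def field_simps)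
  also have "\<dots> \<longleftrightarrow> exp (S - real n * s) < p"
    using p by (metis exp_less_cancel_iff exp_ln)
  finally show ?thesis .
qed (use assms in \<open>auto simp: minus_ln_def\<close>)

lemma minus_ln_antimono: "0 \<le> p \<Longrightarrow> p \<le> q \<Longrightarrow> minus_ln q \<le> minus_ln p"
  by (auto simp: minus_ln_def)

lemma minus_ln_measurable [measurable]: "minus_ln \<in> borel_measurable borel"
  unfolding minus_ln_def[abs_def] by measurable

section \<open>Cover sums and their monotonicity\<close>

lemma infsum_ennreal_eq_SUP:
  fixes g :: "'b \<Rightarrow> ennreal"
  shows "infsum g I = (SUP F\<in>{F. finite F \<and> F \<subseteq> I}. sum g F)"
  by (rule nonneg_infsum_complete) auto

text \<open>Allows a cover to be given as a countable set of pairs, with bounds on finite subsums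
  only; an enumeration of the pairs turns it into a family indexed by natural numbers.\<close>

lemma cover_sum_le:
  assumes "countable S" and Z: "Z \<subseteq> (\<Union>(n, x)\<in>S. bowen_ball f n x \<epsilon>)" and N: "\<And>n x. (n, x) \<in> S \<Longrightarrow> N \<le> n"
    and fin: "\<And>F. finite F \<Longrightarrow> F \<subseteq> S \<Longrightarrow>
       (\<Sum>(n, x)\<in>F. exp (- \<alpha> * real n + birkhoff_sum f \<phi> n x)) \<le> B"
  shows "cover_sum f \<phi> Z \<alpha> N \<epsilon> \<le> ennreal B"
proof -
  define I where "I = to_nat_on S ` S"
  define g where "g = from_nat_into S"
  have gI: "g i \<in> S" if "i \<in> I" for i using that \<open>countable S\<close> by (auto simp: I_def g_def)
  have surj: "\<exists>i\<in>I. g i = p" if "p \<in> S" for p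
    using that \<open>countable S\<close> by (auto simp: I_def g_def)
  have inj: "inj_on g I" using \<open>countable S\<close> by (auto simp: inj_on_def I_def g_def)
  define w where "w p = exp (- \<alpha> * real (fst p) + birkhoff_sum f \<phi> (fst p) (snd p))" for p
  have "cover_sum f \<phi> Z \<alpha> N \<epsilon> \<le> (\<Sum>\<^sub>\<infinity>i\<in>I. ennreal (w (g i)))"
    unfolding cover_sum_def
  proof (rule Inf_lower, rule CollectI, intro exI conjI)
    show "(\<Sum>\<^sub>\<infinity>i\<in>I. ennreal (w (g i))) =
        (\<Sum>\<^sub>\<infinity>i\<in>I. ennreal (exp (- \<alpha> * real ((fst \<circ> g) i) + birkhoff_sum f \<phi> ((fst \<circ> g) i) ((snd \<circ> g) i))))"
      by (simp add: w_def)
    show "Z \<subseteq> (\<Union>i\<in>I. bowen_ball f ((fst \<circ> g) i) ((snd \<circ> g) i) \<epsilon>)"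
    proof
      fix z assume "z \<in> Z"
      then obtain n x where "(n, x) \<in> S" "z \<in> bowen_ball f n x \<epsilon>" using Z by blast
      then show "z \<in> (\<Union>i\<in>I. bowen_ball f ((fst \<circ> g) i) ((snd \<circ> g) i) \<epsilon>)"
        using surj[of "(n, x)"] by force
    qed
    show "\<forall>i\<in>I. N \<le> (fst \<circ> g) i"
      using gI N by (metis comp_apply prod.collapse)
  qed
  also have "\<dots> \<le> ennreal B"
    unfolding infsum_ennreal_eq_SUP
  proof (rule SUP_least)
    fix F assume F: "F \<in> {F. finite F \<and> F \<subseteq> I}"
    then have "(\<Sum>i\<in>F. w (g i)) = (\<Sum>p\<in>g ` F. w p)"
      using inj by (subst sum.reindex) (auto intro: inj_on_subset)
    also have "\<dots> \<le> B" using fin[of "g ` F"] F gI by (auto simp: w_def case_prod_beta)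
    finally show "(\<Sum>i\<in>F. ennreal (w (g i))) \<le> ennreal B"
      by (subst sum_ennreal) (auto simp: w_def intro: ennreal_leI)
  qed
  finally show ?thesis .
qed

lemma cover_sum_mono: "N \<le> N' \<Longrightarrow> cover_sum f \<phi> Z \<alpha> N \<epsilon> \<le> cover_sum f \<phi> Z \<alpha> N' \<epsilon>"
  unfolding cover_sum_def
  by (rule Inf_superset_mono, clarify) (intro exI conjI, rule refl, assumption, auto)

lemma cover_sum_antimono: "\<epsilon> \<le> \<epsilon>' \<Longrightarrow> cover_sum f \<phi> Z \<alpha> N \<epsilon>' \<le> cover_sum f \<phi> Z \<alpha> N \<epsilon>"
  unfolding cover_sum_def
  by (rule Inf_superset_mono, clarify)
    (intro exI conjI, rule refl, erule order_trans, intro UN_mono bowen_ball_mono, auto)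

text \<open>\<open>cover_sum\<close> grows with \<open>N\<close>, so its limit is a supremum, which
  is 0 only if every term is.\<close>

lemma cover_limit_eq_0_iff: "cover_limit f \<phi> Z \<alpha> \<epsilon> = 0 \<longleftrightarrow> (\<forall>N. cover_sum f \<phi> Z \<alpha> N \<epsilon> = 0)"
proof -
  have "(\<lambda>N. cover_sum f \<phi> Z \<alpha> N \<epsilon>) \<longlonglongrightarrow> (SUP N. cover_sum f \<phi> Z \<alpha> N \<epsilon>)"
    by (intro LIMSEQ_SUP) (auto simp: incseq_def cover_sum_mono)
  then have "cover_limit f \<phi> Z \<alpha> \<epsilon> = (SUP N. cover_sum f \<phi> Z \<alpha> N \<epsilon>)"
    unfolding cover_limit_def by (rule limI)
  then show ?thesis by (simp add: SUP_eq_iff bot_ennreal[symmetric] del: bot_ennreal)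
qed

lemma set_pressure_antimono:
  assumes "\<epsilon> \<le> \<epsilon>'"
  shows "set_pressure f \<phi> Z \<epsilon>' \<le> set_pressure f \<phi> Z \<epsilon>"
proof -
  have "{\<alpha>. cover_limit f \<phi> Z \<alpha> \<epsilon> = 0} \<subseteq> {\<alpha>. cover_limit f \<phi> Z \<alpha> \<epsilon>' = 0}"
    using cover_sum_antimono[OF assms, of f \<phi> Z] unfolding cover_limit_eq_0_iff
    by (auto) (metis le_zero_eq)
  then show ?thesis unfolding set_pressure_def by (intro Inf_superset_mono image_mono)
qed

lemma measure_pressure_at_antimono:
  "\<epsilon> \<le> \<epsilon>' \<Longrightarrow> measure_pressure_at \<mu> f \<phi> \<epsilon>' \<le> measure_pressure_at \<mu> f \<phi> \<epsilon>"
  unfolding measure_pressure_at_def by (intro INF_mono) (auto intro: set_pressure_antimono)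

lemma measure_pressure_eq_SUP:
  "measure_pressure \<mu> f \<phi> = (SUP \<epsilon>\<in>{0<..}. measure_pressure_at \<mu> f \<phi> \<epsilon>)"
  unfolding measure_pressure_def by (intro Lim_at_right_0_SUP measure_pressure_at_antimono)

lemma sum_power_le_geometric:
  fixes r :: real
  assumes "finite A" "A \<subseteq> {N..}" "0 \<le> r" "r < 1"
  shows "(\<Sum>n\<in>A. r ^ n) \<le> r ^ N / (1 - r)"
proof -
  have "(\<Sum>n\<in>A. r ^ n) = (\<Sum>n\<in>A. r ^ N * r ^ (n - N))"
    using assms by (intro sum.cong refl) (auto simp: power_add[symmetric])
  also have "\<dots> = r ^ N * (\<Sum>k\<in>(\<lambda>n. n - N) ` A. r ^ k)"
    using assms by (subst sum.reindex) (auto simp: inj_on_def sum_distrib_left subset_iff eq_diff_iff)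
  also have "\<dots> \<le> r ^ N * (\<Sum>k. r ^ k)"
    using assms by (intro mult_left_mono sum_le_suminf summable_geometric) auto
  also have "\<dots> = r ^ N / (1 - r)" using assms by (simp add: suminf_geometric)
  finally show ?thesis .
qed

locale compact_pmp_system = pmp_system M f
  for M :: "'a::metric_space measure" and f +
  assumes compact_UNIV: "compact (UNIV :: 'a set)"
    and continuous_f: "continuous_on UNIV f"
    and sets_borel: "sets M = sets borel"
begin

lemma continuous_iterate: "continuous_on UNIV (f ^^ n)"
proof (induction n)
  case (Suc n)
  then show ?case
    using continuous_on_compose[OF Suc continuous_on_subset[OF continuous_f]] by simp
qed (simp add: id_def)

lemma open_bowen_ball: "0 < n \<Longrightarrow> open (bowen_ball f n x \<epsilon>)"
proof -
  assume n: "0 < n"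
  have "bowen_ball f n x \<epsilon> = (\<Inter>i\<in>{..<n}. {y. dist ((f ^^ i) x) ((f ^^ i) y) < \<epsilon>})"
    using n by (auto simp: bowen_ball_iff)
  moreover have "open {y. dist ((f ^^ i) x) ((f ^^ i) y) < \<epsilon>}" for i
    by (intro open_Collect_less continuous_intros continuous_iterate)
  ultimately show ?thesis by auto
qed

lemma bowen_ball_sets [measurable]: "bowen_ball f n x \<epsilon> \<in> sets M"
proof (cases "n = 0")
  case True
  then have "bowen_ball f n x \<epsilon> = {} \<or> bowen_ball f n x \<epsilon> = UNIV"
    by (auto simp: bowen_ball_def bowen_dist_def)
  then show ?thesis using sets.top[of M] by (auto simp: space_UNIV)
qed (simp add: sets_borel open_bowen_ball)

text \<open>The measure of a Bowen ball is a lower semicontinuous function of its center.\<close>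

lemma measure_bowen_ball_measurable [measurable]:
  "(\<lambda>x. measure M (bowen_ball f n x \<epsilon>)) \<in> borel_measurable M"
proof (cases "n = 0")
  case True
  then have "(\<lambda>x. measure M (bowen_ball f n x \<epsilon>)) = (\<lambda>x. measure M (bowen_ball f n undefined \<epsilon>))"
    by (auto simp: bowen_ball_def bowen_dist_def)
  then show ?thesis by simp
next
  case False
  then have n: "0 < n" by simp
  have "open {x. a < measure M (bowen_ball f n x \<epsilon>)}" for a
  proof (subst open_subopen, intro ballI)
    fix x assume x: "x \<in> {x. a < measure M (bowen_ball f n x \<epsilon>)}"
    \<comment> \<open>Some concentric ball of radius \<open>\<epsilon> - 1 / Suc k\<close> already
      has measure above \<open>a\<close>, and it lies in the \<epsilon>-ball of every center that is
      within \<open>1 / Suc k\<close> of \<open>x\<close> in the Bowen metric.\<close>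
    define B where "B k = bowen_ball f n x (\<epsilon> - 1 / real (Suc k))" for k
    have UN: "(\<Union>k. B k) = bowen_ball f n x \<epsilon>"
    proof (intro equalityI subsetI)
      fix y assume "y \<in> bowen_ball f n x \<epsilon>"
      then have "0 < \<epsilon> - bowen_dist f n x y" by (simp add: bowen_ball_def)
      then obtain k where "1 / real (Suc k) < \<epsilon> - bowen_dist f n x y" using nat_approx_posE by blast
      then show "y \<in> (\<Union>k. B k)" by (auto simp: B_def bowen_ball_def intro!: exI[of _ k])
    next
      fix y assume "y \<in> (\<Union>k. B k)"
      then obtain k where "y \<in> B k" by auto
      then show "y \<in> bowen_ball f n x \<epsilon>"
        using bowen_ball_mono[of "\<epsilon> - 1 / real (Suc k)" \<epsilon> f n x] by (auto simp: B_def)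
    qed
    have "(\<lambda>k. measure M (B k)) \<longlonglongrightarrow> measure M (\<Union>k. B k)"
    proof (rule finite_Lim_measure_incseq)
      show "incseq B"
        unfolding incseq_def B_def by (auto intro!: bowen_ball_mono divide_left_mono)
    qed (auto simp: B_def)
    then have "eventually (\<lambda>k. a < measure M (B k)) sequentially"
      using x UN by (intro order_tendstoD(1)) auto
    then obtain k where k: "a < measure M (B k)"
      by (meson eventually_happens trivial_limit_sequentially)
    define U where "U = bowen_ball f n x (1 / real (Suc k))"
    have "U \<subseteq> {x. a < measure M (bowen_ball f n x \<epsilon>)}"
    proof
      fix y assume "y \<in> U"
      then have y: "x \<in> bowen_ball f n y (1 / real (Suc k))" unfolding U_def by (rule bowen_ball_sym[OF n])
      have "B k \<subseteq> bowen_ball f n y \<epsilon>"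
        using bowen_ball_triangle[OF n y, of _ "\<epsilon> - 1 / real (Suc k)"] by (auto simp: B_def)
      then have "measure M (B k) \<le> measure M (bowen_ball f n y \<epsilon>)"
        by (intro finite_measure_mono) auto
      then show "y \<in> {x. a < measure M (bowen_ball f n x \<epsilon>)}" using k by auto
    qed
    moreover have "open U" "x \<in> U" using n by (auto simp: U_def open_bowen_ball bowen_ball_center)
    ultimately show "\<exists>T. open T \<and> x \<in> T \<and> T \<subseteq> {x. a < measure M (bowen_ball f n x \<epsilon>)}" by blast
  qed
  then show ?thesis
    by (subst borel_measurable_iff_greater) (auto simp: space_UNIV sets_borel)
qed

lemma continuous_measurable: "continuous_on UNIV (\<phi> :: 'a \<Rightarrow> real) \<Longrightarrow> \<phi> \<in> borel_measurable M"
  using borel_measurable_continuous_onI[of \<phi>] measurable_cong_sets[OF sets_borel refl] by blast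

text \<open>\<open>E\<close> is a 2\<epsilon>-separated subset of \<open>G\<close> of largest
  cardinality, so an uncovered point of \<open>G\<close> could be added to it. Cardinalities are
  bounded because each ball of a finite cover by \<epsilon>-balls contains at most one point of a
  separated set. As the centers lie in \<open>G\<close>, lower bounds for balls around points of
  \<open>G\<close> apply to them.\<close>

lemma separated_cover:
  assumes n: "0 < n" and e: "0 < \<epsilon>"
  obtains E where "finite E" "E \<subseteq> G" "G \<subseteq> (\<Union>x\<in>E. bowen_ball f n x (2 * \<epsilon>))"
    "disjoint_family_on (\<lambda>x. bowen_ball f n x \<epsilon>) E"
proof -
  obtain C where C: "finite C" "UNIV \<subseteq> (\<Union>c\<in>C. bowen_ball f n c \<epsilon>)"
  proof (rule compactE_image[OF compact_UNIV])
    show "UNIV \<subseteq> (\<Union>c\<in>UNIV. bowen_ball f n c \<epsilon>)" using bowen_ball_center[OF n e] by auto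
  qed (use open_bowen_ball[OF n] in auto)
  define sep where "sep S \<longleftrightarrow> (\<forall>y\<in>S. \<forall>z\<in>S. y \<noteq> z \<longrightarrow> z \<notin> bowen_ball f n y (2 * \<epsilon>))" for S
  have bound: "finite S \<and> card S \<le> card C" if S: "sep S" for S
  proof -
    have "\<forall>y. \<exists>c. c \<in> C \<and> y \<in> bowen_ball f n c \<epsilon>" using C(2) by auto
    from choice[OF this] obtain h where h: "\<And>y. h y \<in> C" "\<And>y. y \<in> bowen_ball f n (h y) \<epsilon>"
      by blast
    have "inj_on h S"
    proof (rule inj_onI, rule ccontr)
      fix y z assume yz: "y \<in> S" "z \<in> S" "h y = h z" "y \<noteq> z"
      have "h y \<in> bowen_ball f n y \<epsilon>" by (rule bowen_ball_sym[OF n h(2)])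
      moreover have "z \<in> bowen_ball f n (h y) \<epsilon>" using h(2)[of z] yz by simp
      ultimately have "z \<in> bowen_ball f n y (\<epsilon> + \<epsilon>)" by (rule bowen_ball_triangle[OF n])
      then show False using S yz by (simp add: sep_def)
    qed
    moreover have "h ` S \<subseteq> C" using h by auto
    ultimately show ?thesis using C(1) by (metis card_inj_on_le inj_on_finite)
  qed
  have "\<exists>E. (E \<subseteq> G \<and> sep E) \<and> (\<forall>S. S \<subseteq> G \<and> sep S \<longrightarrow> card S \<le> card E)"
    by (rule ex_has_greatest_nat[of _ "{}" _ "Suc (card C)"]) (use bound in \<open>auto simp: sep_def less_Suc_eq_le\<close>)
  then obtain E where E: "E \<subseteq> G" "sep E" "\<And>S. S \<subseteq> G \<Longrightarrow> sep S \<Longrightarrow> card S \<le> card E" by blast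
  have finE: "finite E" using bound E by blast
  show ?thesis
  proof (rule that[OF finE E(1)])
    show "G \<subseteq> (\<Union>x\<in>E. bowen_ball f n x (2 * \<epsilon>))"
    proof (rule ccontr)
      assume "\<not> ?thesis"
      then obtain y where y: "y \<in> G" "\<And>x. x \<in> E \<Longrightarrow> y \<notin> bowen_ball f n x (2 * \<epsilon>)" by auto
      have "y \<notin> E" using y(2)[of y] bowen_ball_center[OF n, of "2 * \<epsilon>" y] e by auto
      moreover have "sep (insert y E)"
        using E(2) y(2) bowen_ball_sym[OF n, of _ f y "2 * \<epsilon>"] unfolding sep_def by blast
      then have "card (insert y E) \<le> card E" using E(1) y(1) by (intro E(3)) auto
      ultimately show False using finE by simp
    qed
    show "disjoint_family_on (\<lambda>x. bowen_ball f n x \<epsilon>) E"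
    proof (clarsimp simp: disjoint_family_on_def, rule ccontr)
      fix y z assume yz: "y \<in> E" "z \<in> E" "y \<noteq> z" "bowen_ball f n y \<epsilon> \<inter> bowen_ball f n z \<epsilon> \<noteq> {}"
      then obtain x where x: "x \<in> bowen_ball f n y \<epsilon>" "x \<in> bowen_ball f n z \<epsilon>" by auto
      have "z \<in> bowen_ball f n x \<epsilon>" by (rule bowen_ball_sym[OF n x(2)])
      from bowen_ball_triangle[OF n x(1) this] show False using E(2) yz by (simp add: sep_def)
    qed
  qed
qed

definition pressure_at :: "('a \<Rightarrow> real) \<Rightarrow> real \<Rightarrow> 'a \<Rightarrow> ereal" where
  "pressure_at \<phi> \<epsilon> x = liminf (\<lambda>n. ereal (1 / real n) *
     (minus_ln (measure M (bowen_ball f n x \<epsilon>)) + ereal (birkhoff_sum f \<phi> n x)))"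

lemma pressure_at_antimono: "\<epsilon> \<le> \<epsilon>' \<Longrightarrow> pressure_at \<phi> \<epsilon>' x \<le> pressure_at \<phi> \<epsilon> x"
  unfolding pressure_at_def
  by (intro Liminf_mono always_eventually allI ereal_mult_left_mono add_right_mono
      minus_ln_antimono finite_measure_mono bowen_ball_mono) auto

lemma pressure_at_measurable [measurable]:
  assumes [measurable]: "\<phi> \<in> borel_measurable M"
  shows "pressure_at \<phi> \<epsilon> \<in> borel_measurable M"
  unfolding pressure_at_def by measurable

lemma pointwise_pressure_eq_SUP:
  "pointwise_pressure M f \<phi> x = (SUP \<epsilon>\<in>{0<..}. pressure_at \<phi> \<epsilon> x)"
  unfolding pointwise_pressure_def pressure_at_def[symmetric]
  by (intro Lim_at_right_0_SUP pressure_at_antimono)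

lemma pointwise_pressure_eq_SUP_nat:
  "pointwise_pressure M f \<phi> x = (SUP k. pressure_at \<phi> (1 / real (Suc k)) x)"
  unfolding pointwise_pressure_eq_SUP
  by (intro SUP_at_right_0_eq_inverse_Suc pressure_at_antimono)

lemma pointwise_pressure_measurable [measurable]:
  assumes [measurable]: "\<phi> \<in> borel_measurable M"
  shows "pointwise_pressure M f \<phi> \<in> borel_measurable M"
  unfolding pointwise_pressure_eq_SUP_nat[abs_def] by measurable

text \<open>Makes the facts about pressure available for local entropy.\<close>

lemma local_entropy_eq_pointwise_pressure: "local_entropy M f x = pointwise_pressure M f (\<lambda>_. 0) x"
  unfolding local_entropy_def pointwise_pressure_def
  by (simp add: birkhoff_sum_def zero_ereal_def[symmetric])

section \<open>Comparison of the pressure of a measure with the point-wise pressures\<close>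

text \<open>At level \<open>n\<close> the disjoint \<epsilon>-balls have total measure at most 1, so
  for the exponent \<open>s + \<delta>\<close> the centers weigh at most
  \<open>exp (- \<delta>) ^ n\<close>. The surplus \<delta> thus turns the sum over all levels from
  \<open>N\<close> on into a geometric tail.\<close>

lemma measure_pressure_at_le:
  assumes [measurable]: "\<phi> \<in> borel_measurable M" and e: "0 < \<epsilon>"
    and AE: "AE x in M. pressure_at \<phi> \<epsilon> x < ereal s"
  shows "measure_pressure_at M f \<phi> (2 * \<epsilon>) \<le> ereal s"
proof -
  define Z where "Z = {x. pressure_at \<phi> \<epsilon> x < ereal s}"
  have "{x \<in> space M. pressure_at \<phi> \<epsilon> x < ereal s} \<in> sets M" by measurable
  then have Zs: "Z \<in> sets M" by (simp add: Z_def space_UNIV)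
  have Z1: "measure M Z = 1"
    using prob_Collect_eq_1[of "\<lambda>x. pressure_at \<phi> \<epsilon> x < ereal s"] AE Zs by (simp add: Z_def space_UNIV)
  have zero: "cover_limit f \<phi> Z (s + \<delta>) (2 * \<epsilon>) = 0" if d: "0 < \<delta>" for \<delta>
  proof -
    define r where "r = exp (- \<delta>)"
    have r: "0 \<le> r" "r < 1" using d by (auto simp: r_def)
    define G where "G n = {x. exp (birkhoff_sum f \<phi> n x - real n * s) < measure M (bowen_ball f n x \<epsilon>)}" for n
    have "\<exists>E. finite E \<and> E \<subseteq> G n \<and> G n \<subseteq> (\<Union>x\<in>E. bowen_ball f n x (2 * \<epsilon>)) \<and>
        disjoint_family_on (\<lambda>x. bowen_ball f n x \<epsilon>) E" if "0 < n" for n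
      using separated_cover[OF that e, of "G n"] by metis
    then obtain E where E: "\<And>n. 0 < n \<Longrightarrow> finite (E n)" "\<And>n. 0 < n \<Longrightarrow> E n \<subseteq> G n"
      "\<And>n. 0 < n \<Longrightarrow> G n \<subseteq> (\<Union>x\<in>E n. bowen_ball f n x (2 * \<epsilon>))"
      "\<And>n. 0 < n \<Longrightarrow> disjoint_family_on (\<lambda>x. bowen_ball f n x \<epsilon>) (E n)"
      by metis
    have bound: "cover_sum f \<phi> Z (s + \<delta>) N (2 * \<epsilon>) \<le> ennreal (r ^ N / (1 - r))" if N: "0 < N" for N
    proof (rule cover_sum_le[where S = "Sigma {N..} E"])
      show "countable (Sigma {N..} E)"
        using E(1) N by (intro countable_SIGMA) (auto intro!: countable_finite)
      show "Z \<subseteq> (\<Union>(n, x)\<in>Sigma {N..} E. bowen_ball f n x (2 * \<epsilon>))"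
      proof
        fix x assume x: "x \<in> Z"
        \<comment> \<open>A lower limit below \<open>s\<close> puts the point in \<open>G n\<close>
          for arbitrarily large \<open>n\<close>; one level beyond \<open>N\<close> is enough to
          cover it.\<close>
        have "\<exists>n\<ge>N. x \<in> G n"
        proof (rule ccontr)
          assume "\<not> ?thesis"
          then have "ereal s \<le> ereal (1 / real n) *
              (minus_ln (measure M (bowen_ball f n x \<epsilon>)) + ereal (birkhoff_sum f \<phi> n x))" if "n \<ge> N" for n
            using that N pressure_term_less_iff[of n "measure M (bowen_ball f n x \<epsilon>)" "birkhoff_sum f \<phi> n x" s]
            by (auto simp: G_def not_less[symmetric])
          then have "ereal s \<le> pressure_at \<phi> \<epsilon> x"
            unfolding pressure_at_def by (intro Liminf_bounded eventually_sequentiallyI[of N])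
          then show False using x by (simp add: Z_def)
        qed
        then obtain n where n: "n \<ge> N" "x \<in> G n" by blast
        then obtain y where "y \<in> E n" "x \<in> bowen_ball f n y (2 * \<epsilon>)" using E(3)[of n] N by auto
        then show "x \<in> (\<Union>(n, x)\<in>Sigma {N..} E. bowen_ball f n x (2 * \<epsilon>))" using n by blast
      qed
      fix F assume F: "finite F" "F \<subseteq> Sigma {N..} E"
      have layer: "(\<Sum>x\<in>E n. exp (- (s + \<delta>) * real n + birkhoff_sum f \<phi> n x)) \<le> r ^ n" if "n \<in> fst ` F" for n
      proof -
        have n: "0 < n" using that F N by auto
        have "(\<Sum>x\<in>E n. exp (- (s + \<delta>) * real n + birkhoff_sum f \<phi> n x)) =
            (\<Sum>x\<in>E n. r ^ n * exp (birkhoff_sum f \<phi> n x - real n * s))"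
          by (simp add: r_def exp_of_nat_mult[symmetric] exp_add[symmetric] algebra_simps)
        also have "\<dots> \<le> (\<Sum>x\<in>E n. r ^ n * measure M (bowen_ball f n x \<epsilon>))"
          using E(2)[OF n] r by (intro sum_mono mult_left_mono) (auto simp: G_def less_imp_le subset_iff)
        also have "\<dots> = r ^ n * measure M (\<Union>x\<in>E n. bowen_ball f n x \<epsilon>)"
          using E(1,4)[OF n] by (subst finite_measure_finite_Union) (auto simp: sum_distrib_left)
        also have "\<dots> \<le> r ^ n * 1" using r by (intro mult_left_mono) auto
        finally show ?thesis by simp
      qed
      have "(\<Sum>(n, x)\<in>F. exp (- (s + \<delta>) * real n + birkhoff_sum f \<phi> n x)) \<le>
          (\<Sum>(n, x)\<in>Sigma (fst ` F) E. exp (- (s + \<delta>) * real n + birkhoff_sum f \<phi> n x))"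
        using F E(1) N by (intro sum_mono2 finite_SigmaI) (auto intro: rev_image_eqI)
      also have "\<dots> = (\<Sum>n\<in>fst ` F. \<Sum>x\<in>E n. exp (- (s + \<delta>) * real n + birkhoff_sum f \<phi> n x))"
        using F E(1) N by (subst sum.Sigma[symmetric]) auto
      also have "\<dots> \<le> (\<Sum>n\<in>fst ` F. r ^ n)" by (intro sum_mono layer)
      also have "\<dots> \<le> r ^ N / (1 - r)" using F r by (intro sum_power_le_geometric) auto
      finally show "(\<Sum>(n, x)\<in>F. exp (- (s + \<delta>) * real n + birkhoff_sum f \<phi> n x)) \<le> r ^ N / (1 - r)" .
    qed auto
    have lim: "(\<lambda>N. ennreal (r ^ N / (1 - r))) \<longlonglongrightarrow> ennreal (0 / (1 - r))"
      using r by (intro tendsto_ennrealI tendsto_divide LIMSEQ_power_zero tendsto_const) auto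
    \<comment> \<open>By monotonicity the bounds at all later lengths apply to \<open>N\<close> as
      well and force the value 0.\<close>
    have "cover_sum f \<phi> Z (s + \<delta>) N (2 * \<epsilon>) \<le> ennreal (0 / (1 - r))" for N
    proof (rule LIMSEQ_le_const[OF lim], intro exI allI impI)
      fix n assume n: "Suc N \<le> n"
      have "cover_sum f \<phi> Z (s + \<delta>) N (2 * \<epsilon>) \<le> cover_sum f \<phi> Z (s + \<delta>) n (2 * \<epsilon>)"
        by (rule cover_sum_mono) (use n in auto)
      also have "\<dots> \<le> ennreal (r ^ n / (1 - r))" by (rule bound) (use n in auto)
      finally show "cover_sum f \<phi> Z (s + \<delta>) N (2 * \<epsilon>) \<le> ennreal (r ^ n / (1 - r))" .
    qed
    then show ?thesis by (simp add: cover_limit_eq_0_iff)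
  qed
  show ?thesis
  proof (rule ereal_le_epsilon2)
    fix \<delta> :: real assume "0 < \<delta>"
    have "measure_pressure_at M f \<phi> (2 * \<epsilon>) \<le> set_pressure f \<phi> Z (2 * \<epsilon>)"
      unfolding measure_pressure_at_def by (rule INF_lower) (use Zs Z1 in auto)
    also have "\<dots> \<le> ereal (s + \<delta>)"
      unfolding set_pressure_def by (rule Inf_lower) (use zero[OF \<open>0 < \<delta>\<close>] in auto)
    finally show "measure_pressure_at M f \<phi> (2 * \<epsilon>) \<le> ereal s + ereal \<delta>" by simp
  qed
qed

text \<open>Mass distribution: each ball of a cover captures at most its weight of the measure of
  \<open>A\<close>, and as \<open>Z\<close> has full measure the balls together capture all of it.
  Balls that miss \<open>A\<close> capture nothing, so \<open>small\<close> concerns only balls that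
  meet \<open>A\<close>.\<close>

lemma measure_le_cover_sum:
  assumes A: "A \<in> sets M" and Z: "Z \<in> sets M" "measure M Z = 1" and N: "0 < N"
    and small: "\<And>n x y. N \<le> n \<Longrightarrow> y \<in> A \<Longrightarrow> y \<in> bowen_ball f n x \<epsilon> \<Longrightarrow>
        measure M (bowen_ball f n x \<epsilon>) \<le> exp (- \<alpha> * real n + birkhoff_sum f \<phi> n x)"
  shows "ennreal (measure M A) \<le> cover_sum f \<phi> Z \<alpha> N \<epsilon>"
  unfolding cover_sum_def
proof (rule Inf_greatest, clarify)
  fix I :: "nat set" and xs :: "nat \<Rightarrow> 'a" and ns :: "nat \<Rightarrow> nat"
  assume cov: "Z \<subseteq> (\<Union>i\<in>I. bowen_ball f (ns i) (xs i) \<epsilon>)" and ns: "\<forall>i\<in>I. N \<le> ns i"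
  define B where "B i = bowen_ball f (ns i) (xs i) \<epsilon>" for i
  define w where "w i = exp (- \<alpha> * real (ns i) + birkhoff_sum f \<phi> (ns i) (xs i))" for i
  have AB: "measure M (A \<inter> B i) \<le> w i" if "i \<in> I" for i
  proof (cases "A \<inter> B i = {}")
    case True
    then show ?thesis by (simp add: w_def)
  next
    case False
    then obtain y where "y \<in> A" "y \<in> B i" by auto
    then have "measure M (B i) \<le> w i" using small[of "ns i" y "xs i"] ns that by (simp add: B_def w_def)
    moreover have "measure M (A \<inter> B i) \<le> measure M (B i)" by (intro finite_measure_mono) (auto simp: B_def)
    ultimately show ?thesis by simp
  qed
  have "emeasure M A = emeasure M (A \<inter> Z)"
  proof (rule emeasure_eq_AE)
    have "AE x in M. x \<in> Z" by (rule AE_prob_1[OF Z(2)])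
    then show "AE x in M. x \<in> A \<longleftrightarrow> x \<in> A \<inter> Z" by eventually_elim auto
  qed (use A Z in auto)
  \<comment> \<open>Exhausting the cover by finite subfamilies matches \<open>infsum\<close>, which
    is a supremum of finite sums.\<close>
  also have "\<dots> \<le> emeasure M (\<Union>n. \<Union>i\<in>I \<inter> {..n}. A \<inter> B i)"
    using cov A by (intro emeasure_mono) (auto simp: B_def, blast)
  also have "\<dots> = (SUP n. emeasure M (\<Union>i\<in>I \<inter> {..n}. A \<inter> B i))"
  proof (rule SUP_emeasure_incseq[symmetric])
    show "incseq (\<lambda>n. \<Union>i\<in>I \<inter> {..n}. A \<inter> B i)" by (intro incseq_SucI UN_mono) auto
    show "range (\<lambda>n. \<Union>i\<in>I \<inter> {..n}. A \<inter> B i) \<subseteq> sets M"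
      using A by (auto simp: B_def intro!: sets.finite_UN)
  qed
  also have "\<dots> \<le> (\<Sum>\<^sub>\<infinity>i\<in>I. ennreal (w i))"
  proof (rule SUP_least)
    fix n
    have "emeasure M (\<Union>i\<in>I \<inter> {..n}. A \<inter> B i) \<le> (\<Sum>i\<in>I \<inter> {..n}. emeasure M (A \<inter> B i))"
      using A by (intro emeasure_subadditive_finite) (auto simp: B_def)
    also have "\<dots> \<le> (\<Sum>i\<in>I \<inter> {..n}. ennreal (w i))"
      using AB by (intro sum_mono) (auto simp: emeasure_eq_measure intro!: ennreal_leI)
    also have "\<dots> \<le> (\<Sum>\<^sub>\<infinity>i\<in>I. ennreal (w i))"
      unfolding infsum_ennreal_eq_SUP by (intro SUP_upper) auto
    finally show "emeasure M (\<Union>i\<in>I \<inter> {..n}. A \<inter> B i) \<le> (\<Sum>\<^sub>\<infinity>i\<in>I. ennreal (w i))" .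
  qed
  finally show "ennreal (measure M A) \<le>
      (\<Sum>\<^sub>\<infinity>i\<in>I. ennreal (exp (- \<alpha> * real (ns i) + birkhoff_sum f \<phi> (ns i) (xs i))))"
    by (simp add: w_def emeasure_eq_measure)
qed

text \<open>Points of \<open>D N\<close> have small \<epsilon>-balls at all times n \<ge> N, but the
  centers of a cover are arbitrary. A ball of radius \<epsilon> / 2 around \<open>x\<close> that
  meets \<open>D N\<close> at \<open>y\<close> lies in the \<epsilon>-ball around \<open>y\<close>,
  and \<open>modulus\<close> moves the Birkhoff sum from \<open>y\<close> to \<open>x\<close> at the
  price \<gamma> per step.\<close>

lemma measure_pressure_at_ge:
  assumes [measurable]: "\<phi> \<in> borel_measurable M" and e: "0 < \<epsilon>"
    and modulus: "\<And>x y. dist x y < \<epsilon> / 2 \<Longrightarrow> \<phi> x \<le> \<phi> y + \<gamma>"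
    and AE: "\<not> (AE x in M. pressure_at \<phi> \<epsilon> x \<le> ereal s)"
  shows "ereal (s - \<gamma>) \<le> measure_pressure_at M f \<phi> (\<epsilon> / 2)"
proof -
  define D where "D N = {x \<in> space M. \<forall>n\<ge>N. measure M (bowen_ball f n x \<epsilon>) \<le> exp (birkhoff_sum f \<phi> n x - real n * s)}" for N
  have D[measurable]: "D N \<in> sets M" for N unfolding D_def by measurable
  have "\<exists>N>0. 0 < measure M (D N)"
  proof (rule ccontr)
    assume "\<not> ?thesis"
    \<comment> \<open>\<open>Suc N\<close> keeps \<open>n\<close> positive, as
      \<open>pressure_term_less_iff\<close> demands.\<close>
    then have "AE x in M. x \<notin> D (Suc N)" for N
      using D[of "Suc N"] by (intro AE_not_in) (auto simp: null_sets_def emeasure_eq_measure not_less measure_le_0_iff)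
    then have "AE x in M. \<forall>N. x \<notin> D (Suc N)" by (simp add: AE_all_countable)
    then have "AE x in M. pressure_at \<phi> \<epsilon> x \<le> ereal s"
    proof eventually_elim
      case (elim x)
      show ?case
      proof (rule ccontr)
        assume "\<not> ?thesis"
        then have "eventually (\<lambda>n. ereal s < ereal (1 / real n) *
            (minus_ln (measure M (bowen_ball f n x \<epsilon>)) + ereal (birkhoff_sum f \<phi> n x))) sequentially"
          unfolding pressure_at_def not_le by (rule less_LiminfD)
        then obtain N where N: "\<And>n. n \<ge> N \<Longrightarrow> ereal s < ereal (1 / real n) *
            (minus_ln (measure M (bowen_ball f n x \<epsilon>)) + ereal (birkhoff_sum f \<phi> n x))"
          unfolding eventually_sequentially by blast
        have "x \<in> D (Suc N)"
          unfolding D_def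
        proof (clarsimp simp: space_UNIV)
          fix n assume n: "Suc N \<le> n"
          show "measure M (bowen_ball f n x \<epsilon>) \<le> exp (birkhoff_sum f \<phi> n x - real n * s)"
            using N[of n] n pressure_term_less_iff[of n "measure M (bowen_ball f n x \<epsilon>)" "birkhoff_sum f \<phi> n x" s]
            by (auto simp: not_less[symmetric])
        qed
        then show False using elim by blast
      qed
    qed
    then show False using AE by simp
  qed
  then obtain N where N: "0 < N" "0 < measure M (D N)" by blast
  have cov: "ennreal (measure M (D N)) \<le> cover_sum f \<phi> Z \<alpha> N (\<epsilon> / 2)"
    if Z: "Z \<in> sets M" "measure M Z = 1" and \<alpha>: "\<alpha> \<le> s - \<gamma>" for Z \<alpha>
  proof (rule measure_le_cover_sum[OF D Z N(1)])
    fix n x y assume n: "N \<le> n" and y: "y \<in> D N" "y \<in> bowen_ball f n x (\<epsilon> / 2)"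
    have n0: "0 < n" using n N by simp
    have "bowen_ball f n x (\<epsilon> / 2) \<subseteq> bowen_ball f n y \<epsilon>"
      using bowen_ball_triangle[OF n0, of x f y "\<epsilon> / 2" _ "\<epsilon> / 2"] bowen_ball_sym[OF n0 y(2)] by auto
    then have "measure M (bowen_ball f n x (\<epsilon> / 2)) \<le> measure M (bowen_ball f n y \<epsilon>)"
      by (intro finite_measure_mono) auto
    also have "\<dots> \<le> exp (birkhoff_sum f \<phi> n y - real n * s)" using y(1) n by (simp add: D_def)
    also have "\<dots> \<le> exp (- \<alpha> * real n + birkhoff_sum f \<phi> n x)"
    proof -
      have "birkhoff_sum f \<phi> n y \<le> (\<Sum>i<n. \<phi> ((f ^^ i) x) + \<gamma>)"
        unfolding birkhoff_sum_def using y(2) n0 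
        by (intro sum_mono modulus) (auto simp: bowen_ball_iff dist_commute)
      also have "\<dots> = birkhoff_sum f \<phi> n x + real n * \<gamma>" by (simp add: birkhoff_sum_def sum.distrib)
      finally have "birkhoff_sum f \<phi> n y - real n * s \<le> birkhoff_sum f \<phi> n x - real n * (s - \<gamma>)"
        by (simp add: algebra_simps)
      moreover have "real n * \<alpha> \<le> real n * (s - \<gamma>)" using \<alpha> by (intro mult_left_mono) auto
      ultimately show ?thesis by (simp add: algebra_simps)
    qed
    finally show "measure M (bowen_ball f n x (\<epsilon> / 2)) \<le> exp (- \<alpha> * real n + birkhoff_sum f \<phi> n x)" .
  qed
  show ?thesis
    unfolding measure_pressure_at_def
  proof (rule INF_greatest)
    fix Z assume Z: "Z \<in> {Z \<in> sets M. measure M Z = 1}"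
    show "ereal (s - \<gamma>) \<le> set_pressure f \<phi> Z (\<epsilon> / 2)"
      unfolding set_pressure_def
    proof (rule Inf_greatest, clarify)
      fix \<alpha> assume "cover_limit f \<phi> Z \<alpha> (\<epsilon> / 2) = 0"
      then have "cover_sum f \<phi> Z \<alpha> N (\<epsilon> / 2) = 0" by (simp add: cover_limit_eq_0_iff)
      then show "ereal (s - \<gamma>) \<le> ereal \<alpha>"
        using cov[of Z \<alpha>] Z N(2) by (cases "\<alpha> \<le> s - \<gamma>") (auto simp: ennreal_eq_0_iff)
    qed
  qed
qed

text \<open>Each comparison changes the radius by a factor 2, which the supremum over radii absorbs;
  uniform continuity of \<open>\<phi>\<close> makes the loss \<gamma> arbitrarily small.\<close>

theorem measure_pressure_eq_esssup:
  assumes cont: "continuous_on UNIV \<phi>"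
  shows "measure_pressure M f \<phi> = esssup M (pointwise_pressure M f \<phi>)"
proof (rule antisym)
  have [measurable]: "\<phi> \<in> borel_measurable M" by (rule continuous_measurable[OF cont])
  show "measure_pressure M f \<phi> \<le> esssup M (pointwise_pressure M f \<phi>)"
    unfolding measure_pressure_eq_SUP
  proof (rule SUP_least, rule dense_ge)
    fix \<epsilon> :: real and z assume e: "\<epsilon> \<in> {0<..}" and z: "esssup M (pointwise_pressure M f \<phi>) < z"
    show "measure_pressure_at M f \<phi> \<epsilon> \<le> z"
    proof (cases z)
      case (real s)
      have "AE x in M. pointwise_pressure M f \<phi> x \<le> esssup M (pointwise_pressure M f \<phi>)" by (rule esssup_AE)
      then have "AE x in M. pressure_at \<phi> (\<epsilon> / 2) x < ereal s"
      proof eventually_elim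
        case (elim x)
        have "pressure_at \<phi> (\<epsilon> / 2) x \<le> pointwise_pressure M f \<phi> x"
          unfolding pointwise_pressure_eq_SUP using e by (intro SUP_upper) auto
        then show ?case using elim z real by (metis order.strict_trans1)
      qed
      from measure_pressure_at_le[OF _ _ this] show ?thesis using e real by simp
    qed (use z in auto)
  qed
  show "esssup M (pointwise_pressure M f \<phi>) \<le> measure_pressure M f \<phi>"
  proof (rule dense_le)
    fix z assume z: "z < esssup M (pointwise_pressure M f \<phi>)"
    show "z \<le> measure_pressure M f \<phi>"
    proof (cases z)
      case (real s)
      have "\<not> (AE x in M. pointwise_pressure M f \<phi> x \<le> ereal s)"
        using esssup_I[of "pointwise_pressure M f \<phi>" M "ereal s"] z real by auto
      \<comment> \<open>With countably many radii, failure of the bound for the supremum means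
        failure at a single radius.\<close>
      then have "\<not> (\<forall>k. AE x in M. pressure_at \<phi> (1 / real (Suc k)) x \<le> ereal s)"
        unfolding pointwise_pressure_eq_SUP_nat by (simp add: SUP_le_iff AE_all_countable)
      then obtain k where k: "\<not> (AE x in M. pressure_at \<phi> (1 / real (Suc k)) x \<le> ereal s)" by blast
      show ?thesis unfolding real
      proof (rule ereal_le_epsilon2)
        fix \<gamma> :: real assume g: "0 < \<gamma>"
        have "uniformly_continuous_on UNIV \<phi>" by (rule compact_uniformly_continuous[OF cont compact_UNIV])
        then obtain d where d: "0 < d" "\<And>x y. dist x y < d \<Longrightarrow> dist (\<phi> x) (\<phi> y) < \<gamma>"
          using g unfolding uniformly_continuous_on_def by (metis UNIV_I dist_commute)
        \<comment> \<open>\<open>pressure_at\<close> only grows when the radius shrinks, so the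
          radius can be adapted to the modulus of continuity.\<close>
        define \<epsilon> where "\<epsilon> = min (1 / real (Suc k)) d"
        have e: "0 < \<epsilon>" using d by (simp add: \<epsilon>_def)
        have "\<not> (AE x in M. pressure_at \<phi> \<epsilon> x \<le> ereal s)"
        proof
          assume "AE x in M. pressure_at \<phi> \<epsilon> x \<le> ereal s"
          then have "AE x in M. pressure_at \<phi> (1 / real (Suc k)) x \<le> ereal s"
            by eventually_elim (rule order_trans[OF pressure_at_antimono], auto simp: \<epsilon>_def)
          then show False using k by simp
        qed
        moreover have "\<phi> x \<le> \<phi> y + \<gamma>" if "dist x y < \<epsilon> / 2" for x y
          using d(2)[of x y] that e by (auto simp: \<epsilon>_def dist_real_def)
        ultimately have "ereal (s - \<gamma>) \<le> measure_pressure_at M f \<phi> (\<epsilon> / 2)"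
          using e by (intro measure_pressure_at_ge) auto
        also have "\<dots> \<le> measure_pressure M f \<phi>"
          unfolding measure_pressure_eq_SUP using e by (intro SUP_upper) auto
        finally show "ereal s \<le> measure_pressure M f \<phi> + ereal \<gamma>"
          by (cases "measure_pressure M f \<phi>") auto
      qed
    qed (use z in auto)
  qed
qed

lemma continuous_bounded:
  assumes "continuous_on UNIV (\<phi> :: 'a \<Rightarrow> real)"
  shows "\<exists>C. \<forall>x. \<bar>\<phi> x\<bar> \<le> C"
  using compact_imp_bounded[OF compact_continuous_image[OF assms compact_UNIV]]
  by (auto simp: bounded_iff)

text \<open>A convergent real sequence splits off from a lower limit, and the finite constant it
  leaves splits off from the supremum over radii, even where the local entropy is infinite.\<close>

lemma AE_pointwise_pressure:
  assumes cont: "continuous_on UNIV \<phi>"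
  shows "AE x in M. pointwise_pressure M f \<phi> x = local_entropy M f x + ereal (birkhoff_average f \<phi> x)"
proof -
  have [measurable]: "\<phi> \<in> borel_measurable M" by (rule continuous_measurable[OF cont])
  obtain C where C: "\<And>x. \<bar>\<phi> x\<bar> \<le> C" using continuous_bounded[OF cont] by blast
  have "AE x in M. (\<lambda>n. 1 / real n * birkhoff_sum f \<phi> n x) \<longlonglongrightarrow> birkhoff_average f \<phi> x"
    by (rule birkhoff_ergodic[OF _ C]) measurable
  then show ?thesis
  proof eventually_elim
    case (elim x)
    have "pressure_at \<phi> \<epsilon> x = ereal (birkhoff_average f \<phi> x) + pressure_at (\<lambda>_. 0) \<epsilon> x" for \<epsilon>
    proof -
      have "pressure_at \<phi> \<epsilon> x = liminf (\<lambda>n. ereal (1 / real n * birkhoff_sum f \<phi> n x) +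
          ereal (1 / real n) * minus_ln (measure M (bowen_ball f n x \<epsilon>)))"
        unfolding pressure_at_def
        by (intro arg_cong[where f = liminf] ext)
          (auto simp: minus_ln_def distrib_left add.commute diff_divide_distrib zero_ereal_def[symmetric])
      also have "\<dots> = ereal (birkhoff_average f \<phi> x) + liminf (\<lambda>n. ereal (1 / real n) * minus_ln (measure M (bowen_ball f n x \<epsilon>)))"
        by (intro ereal_liminf_lim_add) (use elim in auto)
      finally show ?thesis by (simp add: pressure_at_def birkhoff_sum_def zero_ereal_def[symmetric])
    qed
    then show ?case
      unfolding local_entropy_eq_pointwise_pressure pointwise_pressure_eq_SUP
      by (simp add: SUP_ereal_add_right add.commute)
  qed
qed

end

section \<open>Entropy is bounded by pressure\<close>

text \<open>The sum, over all cuttings of \<open>w\<close> into nonempty blocks, of the product of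
  the block weights. The greedy parsing depends on the point and not only on its itinerary; this sum
  dominates the weight of each single parsing and depends on the word alone.\<close>

function parsing_weight :: "('b list \<Rightarrow> real) \<Rightarrow> 'b list \<Rightarrow> real" where
  "parsing_weight a w =
     (if w = [] then 1 else \<Sum>m\<in>{1..length w}. a (take m w) * parsing_weight a (drop m w))"
  by pat_completeness auto
termination by (relation "Wellfounded.measure (length \<circ> snd)") auto

declare parsing_weight.simps [simp del]

lemma parsing_weight_Nil [simp]: "parsing_weight a [] = 1"
  by (simp add: parsing_weight.simps)

lemma parsing_weight_nonneg:
  assumes "\<And>u. 0 \<le> a u"
  shows "0 \<le> parsing_weight a w"
proof (induction w rule: length_induct)
  case (1 w)
  then show ?case
    by (subst parsing_weight.simps) (auto intro!: sum_nonneg mult_nonneg_nonneg assms)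
qed

lemma parsing_weight_append:
  assumes a: "\<And>u. 0 \<le> a u" and u: "u \<noteq> []"
  shows "a u * parsing_weight a v \<le> parsing_weight a (u @ v)"
proof -
  have "a (take (length u) (u @ v)) * parsing_weight a (drop (length u) (u @ v)) \<le>
      (\<Sum>m\<in>{1..length (u @ v)}. a (take m (u @ v)) * parsing_weight a (drop m (u @ v)))"
    by (rule member_le_sum[where f = "\<lambda>m. a (take m (u @ v)) * parsing_weight a (drop m (u @ v))"])
      (use u in \<open>auto simp: Suc_le_eq intro!: mult_nonneg_nonneg a parsing_weight_nonneg\<close>)
  then show ?thesis using u by (subst parsing_weight.simps) simp
qed

lemma parsing_weight_pos:
  assumes a: "\<And>u. 0 \<le> a u" and single: "\<And>b. b \<in> P \<Longrightarrow> 0 < a [b]" and "set w \<subseteq> P"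
  shows "0 < parsing_weight a w"
  using assms(3)
proof (induction w)
  case (Cons b w)
  then have "0 < a [b] * parsing_weight a w" using single by simp
  then show ?case using parsing_weight_append[where a = a and u = "[b]" and v = w, OF a] by simp
qed simp

text \<open>Splitting off the first block gives a renewal equation: the mass of words of length
  \<open>n\<close> is the sum over \<open>m\<close> of the mass of blocks of length \<open>m\<close>
  times that of words of length \<open>n - m\<close>.\<close>

lemma sum_parsing_weight_le_1:
  assumes "finite P" and a: "\<And>u. 0 \<le> a u"
    and sum: "\<And>n. (\<Sum>m\<in>{1..n}. \<Sum>u\<in>words P m. a u) \<le> 1"
  shows "(\<Sum>w\<in>words P n. parsing_weight a w) \<le> 1"
proof (induction n rule: less_induct)
  case (less n)
  show ?case
  proof (cases "n = 0")
    case True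
    then show ?thesis by (simp only: words_0) simp
  next
    case False
    have "(\<Sum>w\<in>words P n. parsing_weight a w) =
        (\<Sum>w\<in>words P n. \<Sum>m\<in>{1..n}. a (take m w) * parsing_weight a (drop m w))"
      using False by (intro sum.cong refl) (subst parsing_weight.simps, auto)
    also have "\<dots> = (\<Sum>m\<in>{1..n}. \<Sum>w\<in>words P n. a (take m w) * parsing_weight a (drop m w))"
      by (rule sum.swap)
    also have "\<dots> \<le> (\<Sum>m\<in>{1..n}. \<Sum>u\<in>words P m. a u)"
    proof (rule sum_mono)
      fix m assume m: "m \<in> {1..n}"
      have "(\<Sum>w\<in>words P n. a (take m w) * parsing_weight a (drop m w)) =
          (\<Sum>w\<in>words P (m + (n - m)). a (take m w) * parsing_weight a (drop m w))" using m by simp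
      also have "\<dots> = (\<Sum>u\<in>words P m. \<Sum>v\<in>words P (n - m). a (take m (u @ v)) * parsing_weight a (drop m (u @ v)))"
        by (rule sum_words_append[OF assms(1)])
      also have "\<dots> = (\<Sum>u\<in>words P m. a u * (\<Sum>v\<in>words P (n - m). parsing_weight a v))"
        unfolding sum_distrib_left by (intro sum.cong refl) auto
      also have "\<dots> \<le> (\<Sum>u\<in>words P m. a u * 1)"
        using less[of "n - m"] m a by (intro sum_mono mult_left_mono) auto
      finally show "(\<Sum>w\<in>words P n. a (take m w) * parsing_weight a (drop m w)) \<le> (\<Sum>u\<in>words P m. a u)"
        by simp
    qed
    also have "\<dots> \<le> 1" by (rule sum)
    finally show ?thesis .
  qed
qed

section \<open>Coding itineraries by Bowen balls\<close>

locale compact_pmp_partition = compact_pmp_system M f + pmp_partition M f P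
  for M :: "'a::metric_space measure" and f and P
begin

text \<open>A word is weighted by its parsings into Bowen balls of the cover and single letters. In the
  block of the \<open>i\<close>-th ball, the letters predicted by the orbit of the center are charged
  \<open>- ln (1 - \<theta>)\<close>, all others \<open>ln (card P / \<theta>)\<close>.\<close>

lemma entropy_le_of_cover:
  fixes xs :: "nat \<Rightarrow> 'a" and ns :: "nat \<Rightarrow> nat" and s \<theta> \<epsilon> :: real
  assumes J: "finite J" "\<And>i. i \<in> J \<Longrightarrow> 0 < ns i" and weight: "(\<Sum>i\<in>J. exp (- s * real (ns i))) \<le> 1 / 2"
    and K [measurable]: "K \<in> sets M"
    and guess: "\<And>z y. dist z y < \<epsilon> \<Longrightarrow> y \<in> K \<Longrightarrow> cell y = g z"
    and \<theta>: "0 < \<theta>" "\<theta> < 1"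
  shows "entropy_wrt_partition M f P \<le> s - ln (1 - \<theta>) + ln (card P / \<theta>) * measure M (- K) +
    (ln (2 * card P) + \<bar>s - ln (1 - \<theta>)\<bar>) * measure M (- (\<Union>i\<in>J. bowen_ball f (ns i) (xs i) \<epsilon>))"
proof -
  define c where "c = real (card P)"
  have c: "1 \<le> c" using finite_P P_nonempty by (simp add: c_def Suc_le_eq card_gt_0_iff)
  \<comment> \<open>A guess for the letter \<open>b\<close> when \<open>d\<close> is predicted: mass
    1 - \<theta> on \<open>d\<close>, and \<theta> spread uniformly so that no letter becomes
    impossible.\<close>
  define t where "t b d = (if b = d then 1 - \<theta> else 0) + \<theta> / c" for b d :: "'a set"
  have t0: "0 \<le> t b d" for b d using \<theta> c by (simp add: t_def)
  have t1: "(\<Sum>b\<in>P. t b d) \<le> 1" for d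
    using \<theta> c finite_P by (auto simp: t_def sum.distrib c_def)
  \<comment> \<open>Single letters share the mass 1/2, being \<open>c\<close> in number; the balls
    get at most the other half by \<open>weight\<close>.\<close>
  define a where "a u = (if length u = 1 then 1 / (2 * c) else 0) +
    (\<Sum>i\<in>J. if ns i = length u then exp (- s * real (ns i)) * (\<Prod>j<length u. t (u ! j) (g ((f ^^ j) (xs i)))) else 0)" for u
  have a0: "0 \<le> a u" for u
    using c t0 by (auto simp: a_def intro!: add_nonneg_nonneg sum_nonneg mult_nonneg_nonneg prod_nonneg)
  have a1: "1 / (2 * c) \<le> a [b]" for b
    using c t0 by (auto simp: a_def intro!: sum_nonneg mult_nonneg_nonneg prod_nonneg)
  have asum: "(\<Sum>m\<in>{1..n}. \<Sum>u\<in>words P m. a u) \<le> 1" for n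
  proof -
    have layer: "(\<Sum>u\<in>words P m. a u) \<le> (if m = 1 then 1 / 2 else 0) +
        (\<Sum>i\<in>J. if ns i = m then exp (- s * real (ns i)) else 0)" for m
    proof -
      have "(\<Sum>u\<in>words P m. a u) = (\<Sum>u\<in>words P m. if m = 1 then 1 / (2 * c) else 0) +
          (\<Sum>i\<in>J. \<Sum>u\<in>words P m. if ns i = m then exp (- s * real (ns i)) * (\<Prod>j<m. t (u ! j) (g ((f ^^ j) (xs i)))) else 0)"
        unfolding a_def sum.distrib by (subst (2) sum.swap) (intro arg_cong2[where f = plus] sum.cong refl; auto)
      also have "(\<Sum>u\<in>words P m. if m = 1 then 1 / (2 * c) else 0) = (if m = 1 then 1 / 2 else 0)"
        using card_lists_length_eq[OF finite_P, of m] c by (simp add: c_def)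
      also have "(\<Sum>i\<in>J. \<Sum>u\<in>words P m. if ns i = m then exp (- s * real (ns i)) * (\<Prod>j<m. t (u ! j) (g ((f ^^ j) (xs i)))) else 0)
          \<le> (\<Sum>i\<in>J. if ns i = m then exp (- s * real (ns i)) else 0)"
      proof (rule sum_mono)
        fix i
        have "(\<Sum>u\<in>words P m. \<Prod>j<m. t (u ! j) (g ((f ^^ j) (xs i)))) = (\<Prod>j<m. \<Sum>b\<in>P. t b (g ((f ^^ j) (xs i))))"
          by (rule sum_words_prod[OF finite_P])
        also have "\<dots> \<le> 1" using t1 t0 by (intro prod_le_1) (auto intro: sum_nonneg)
        finally show "(\<Sum>u\<in>words P m. if ns i = m then exp (- s * real (ns i)) * (\<Prod>j<m. t (u ! j) (g ((f ^^ j) (xs i)))) else 0)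
          \<le> (if ns i = m then exp (- s * real (ns i)) else 0)"
          by (simp add: sum_distrib_left[symmetric] mult_left_le)
      qed
      finally show ?thesis by simp
    qed
    have "(\<Sum>m\<in>{1..n}. \<Sum>u\<in>words P m. a u) \<le> (\<Sum>m\<in>{1..n}. (if m = 1 then 1 / 2 else 0) +
        (\<Sum>i\<in>J. if ns i = m then exp (- s * real (ns i)) else 0))"
      by (intro sum_mono layer)
    also have "\<dots> = (\<Sum>m\<in>{1..n}. if m = 1 then 1 / 2 else 0) +
        (\<Sum>i\<in>J. \<Sum>m\<in>{1..n}. if ns i = m then exp (- s * real (ns i)) else 0)"
      unfolding sum.distrib by (subst (2) sum.swap) simp
    also have "\<dots> \<le> 1 / 2 + (\<Sum>i\<in>J. exp (- s * real (ns i)))"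
      by (intro add_mono sum_mono) auto
    finally show ?thesis using weight by simp
  qed
  define q where "q = parsing_weight a"
  have qpos: "0 < q (itinerary n x)" for n x
    unfolding q_def using itinerary_words[of n x] c
    by (intro parsing_weight_pos[where P = P] a0) (auto intro: less_le_trans[OF _ a1])
  \<comment> \<open>\<open>\<beta>\<close> is the allowance per letter, \<open>\<kappa>\<close> the
    surcharge outside \<open>K\<close>; \<open>K'\<close> bounds the cost \<open>ln (2 * c)\<close>
    of a single letter minus the allowance, whatever the sign of \<open>\<beta>\<close>.\<close>
  define \<beta> where "\<beta> = s - ln (1 - \<theta>)"
  define \<kappa> where "\<kappa> = ln (c / \<theta>)"
  define K' where "K' = ln (2 * c) + \<bar>\<beta>\<bar>"
  have \<kappa>0: "0 \<le> \<kappa>" unfolding \<kappa>_def using \<theta> c by (intro ln_ge_zero) (simp add: field_simps)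
  have K'0: "0 \<le> K'" unfolding K'_def using c by (intro add_nonneg_nonneg ln_ge_zero) auto
  define A where "A = - (\<Union>i\<in>J. bowen_ball f (ns i) (xs i) \<epsilon>)"
  have A[measurable]: "A \<in> sets M" unfolding A_def using J(1) by (intro Compl_sets sets.finite_UN) auto
  have K'M[measurable]: "- K \<in> sets M" by (intro Compl_sets K)
  \<comment> \<open>Code length in excess of allowance and surcharges; a block of the cover does not
    raise it, so \<open>greedy_parsing\<close> applies.\<close>
  define L where "L n x = - ln (q (itinerary n x)) - real n * \<beta> - \<kappa> * visits (- K) n x" for n x
  \<comment> \<open>A common bound for the block lengths, available because \<open>J\<close> is
    finite.\<close>
  define N where "N = (\<Sum>i\<in>J. ns i)"
  have app: "- ln (q (itinerary (m + n) x)) \<le> - ln (a (itinerary m x)) - ln (q (itinerary n ((f ^^ m) x)))"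
    if "0 < m" "0 < a (itinerary m x)" for m n x
  proof -
    have "itinerary m x \<noteq> []" using that(1) length_itinerary[of m x] by fastforce
    then have "a (itinerary m x) * q (itinerary n ((f ^^ m) x)) \<le> q (itinerary (m + n) x)"
      unfolding q_def itinerary_add by (intro parsing_weight_append a0)
    then have "ln (a (itinerary m x) * q (itinerary n ((f ^^ m) x))) \<le> ln (q (itinerary (m + n) x))"
      using that qpos by (subst ln_le_cancel_iff) auto
    then show ?thesis using that qpos[of n "(f ^^ m) x"] by (simp add: ln_mult)
  qed
  have pw: "L n x \<le> K' * (visits A n x + real N)" for n x
  proof (rule greedy_parsing[OF _ K'0])
    show "L 0 x \<le> 0" for x by (simp add: L_def q_def itinerary_def visits_def)
    show "L (Suc n) x \<le> K' + L n (f x)" for n x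
    proof -
      have it: "itinerary (Suc 0) x = [cell x]" by (simp add: itinerary_def)
      have pos: "0 < a (itinerary (Suc 0) x)" unfolding it using c by (intro less_le_trans[OF _ a1]) simp
      have "ln (1 / (2 * c)) \<le> ln (a (itinerary (Suc 0) x))"
        using a1[of "cell x"] pos c unfolding it by (subst ln_le_cancel_iff) auto
      then have "- ln (a (itinerary (Suc 0) x)) \<le> ln (2 * c)" using c by (simp add: ln_div)
      moreover have "- ln (q (itinerary (Suc n) x)) \<le> - ln (a (itinerary (Suc 0) x)) - ln (q (itinerary n (f x)))"
        using app[of "Suc 0" x n] pos by simp
      moreover have "\<kappa> * visits (- K) n (f x) \<le> \<kappa> * visits (- K) (Suc n) x"
        using visits_add[of "- K" "Suc 0" n x] visits_nonneg[of "- K" "Suc 0" x] \<kappa>0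
        by (intro mult_left_mono) auto
      ultimately show ?thesis by (simp add: L_def K'_def algebra_simps)
    qed
    show "\<exists>m\<in>{1..N}. \<forall>n. L (m + n) x \<le> L n ((f ^^ m) x)" if x: "x \<notin> A" for x
    proof -
      obtain i where i: "i \<in> J" "x \<in> bowen_ball f (ns i) (xs i) \<epsilon>" using x by (auto simp: A_def)
      define m where "m = ns i"
      have m: "0 < m" "m \<le> N" using J i by (auto simp: m_def N_def intro: member_le_sum)
      have letter: "exp (ln (1 - \<theta>) - \<kappa> * indicator (- K) ((f ^^ j) x)) \<le> t (cell ((f ^^ j) x)) (g ((f ^^ j) (xs i)))"
        if j: "j < m" for j
      proof (cases "(f ^^ j) x \<in> K")
        case True
        have "dist ((f ^^ j) (xs i)) ((f ^^ j) x) < \<epsilon>" using i(2) j m by (simp add: bowen_ball_iff m_def)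
        then have "cell ((f ^^ j) x) = g ((f ^^ j) (xs i))" using True by (rule guess)
        then show ?thesis using True \<theta> c by (simp add: t_def)
      next
        case False
        \<comment> \<open>The surcharge is added to \<open>- ln (1 - \<theta>)\<close> instead of
          replacing it, which is harmless for an upper bound on the code length.\<close>
        have "exp (ln (1 - \<theta>) - \<kappa> * indicator (- K) ((f ^^ j) x)) = (1 - \<theta>) * (\<theta> / c)"
          using False \<theta> c by (simp add: exp_diff \<kappa>_def)
        also have "\<dots> \<le> 1 * (\<theta> / c)" using \<theta> c by (intro mult_right_mono) auto
        also have "\<dots> \<le> t (cell ((f ^^ j) x)) (g ((f ^^ j) (xs i)))" using \<theta> by (simp add: t_def)
        finally show ?thesis .
      qed
      have "exp (- (real m * \<beta> + \<kappa> * visits (- K) m x)) =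
          exp (- s * real m) * exp (\<Sum>j<m. ln (1 - \<theta>) - \<kappa> * indicator (- K) ((f ^^ j) x))"
        unfolding exp_add[symmetric] sum_subtractf
        by (simp add: \<beta>_def visits_def sum_distrib_left algebra_simps)
      also have "\<dots> = exp (- s * real m) * (\<Prod>j<m. exp (ln (1 - \<theta>) - \<kappa> * indicator (- K) ((f ^^ j) x)))"
        by (simp add: exp_sum)
      also have "\<dots> \<le> exp (- s * real m) * (\<Prod>j<m. t (cell ((f ^^ j) x)) (g ((f ^^ j) (xs i))))"
        by (intro mult_left_mono prod_mono) (use letter in auto)
      also have "\<dots> \<le> a (itinerary m x)"
      proof -
        let ?F = "\<lambda>i. if ns i = length (itinerary m x) then exp (- s * real (ns i)) *
            (\<Prod>j<length (itinerary m x). t (itinerary m x ! j) (g ((f ^^ j) (xs i)))) else 0"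
        have "exp (- s * real m) * (\<Prod>j<m. t (cell ((f ^^ j) x)) (g ((f ^^ j) (xs i)))) = ?F i"
          by (simp add: m_def)
        also have "?F i \<le> (\<Sum>i\<in>J. ?F i)"
          using i(1) J(1) t0 by (intro member_le_sum) (auto intro!: mult_nonneg_nonneg prod_nonneg)
        also have "\<dots> \<le> a (itinerary m x)" using c by (simp add: a_def)
        finally show ?thesis .
      qed
      finally have low: "exp (- (real m * \<beta> + \<kappa> * visits (- K) m x)) \<le> a (itinerary m x)" .
      then have pos: "0 < a (itinerary m x)" using exp_gt_zero less_le_trans by blast
      have "- (real m * \<beta> + \<kappa> * visits (- K) m x) \<le> ln (a (itinerary m x))"
        using low pos by (metis exp_ln exp_le_cancel_iff)
      then have "L (m + n) x \<le> L n ((f ^^ m) x)" for n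
        using app[OF m(1) pos, of n] by (simp add: L_def visits_add algebra_simps)
      then show ?thesis using m by (intro bexI[of _ m]) auto
    qed
  qed
  have key: "join_entropy n / real n \<le> \<beta> + \<kappa> * measure M (- K) + K' * measure M A + K' * real N / real n" if n: "1 \<le> n" for n
  proof -
    have "join_entropy n \<le> (\<integral>x. - ln (q (itinerary n x)) \<partial>M)"
    proof (rule join_entropy_le_integral)
      show "(\<Sum>w\<in>words P n. q w) \<le> 1"
        unfolding q_def by (rule sum_parsing_weight_le_1[OF finite_P a0 asum])
      show "0 \<le> q w" for w unfolding q_def by (rule parsing_weight_nonneg[OF a0])
      show "0 < q w" if "w \<in> words P n" for w
        unfolding q_def using that c
        by (intro parsing_weight_pos[where P = P] a0) (auto intro: less_le_trans[OF _ a1])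
    qed
    also have "\<dots> \<le> (\<integral>x. real n * \<beta> + \<kappa> * visits (- K) n x + K' * (visits A n x + real N) \<partial>M)"
    proof (rule integral_mono)
      show "integrable M (\<lambda>x. - ln (q (itinerary n x)))"
        using integrable_itinerary[of "\<lambda>w. - ln (q w)"] .
      show "integrable M (\<lambda>x. real n * \<beta> + \<kappa> * visits (- K) n x + K' * (visits A n x + real N))"
        using visits_integrable[OF A, of n] visits_integrable[OF K'M, of n] by auto
      show "- ln (q (itinerary n x)) \<le> real n * \<beta> + \<kappa> * visits (- K) n x + K' * (visits A n x + real N)" for x
        using pw[of n x] by (simp add: L_def)
    qed
    also have "\<dots> = real n * \<beta> + \<kappa> * (real n * measure M (- K)) + K' * (real n * measure M A + real N)"
      using visits_integrable[OF A, of n] visits_integrable[OF K'M, of n] prob_space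
      by (simp add: integral_visits)
    finally show ?thesis using n by (simp add: field_simps)
  qed
  have "(\<lambda>n. \<beta> + \<kappa> * measure M (- K) + K' * measure M A + K' * real N / real n) \<longlonglongrightarrow>
      \<beta> + \<kappa> * measure M (- K) + K' * measure M A + 0"
    by (intro tendsto_add tendsto_const lim_const_over_n)
  then have "entropy_wrt_partition M f P \<le> \<beta> + \<kappa> * measure M (- K) + K' * measure M A + 0"
    by (rule LIMSEQ_le[OF join_entropy_LIMSEQ]) (use key in blast)
  then show ?thesis by (simp add: \<beta>_def \<kappa>_def K'_def A_def c_def)
qed

text \<open>Cells are merely Borel, so nearby points may lie in different cells. Regularity replaces
  the cells by closed subsets at the price \<eta> in measure, and compactness separates these:
  within \<epsilon> of any \<open>z\<close> only one of them can be met.\<close>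

lemma closed_core:
  assumes \<eta>: "0 < \<eta>"
  obtains K \<epsilon> g where "K \<in> sets M" "measure M (- K) \<le> \<eta>" "0 < \<epsilon>"
    "\<And>z y. dist z y < \<epsilon> \<Longrightarrow> y \<in> K \<Longrightarrow> cell y = g z"
proof -
  define c where "c = real (card P)"
  have c: "1 \<le> c" using finite_P P_nonempty by (simp add: c_def Suc_le_eq card_gt_0_iff)
  have "\<exists>F. closed F \<and> F \<subseteq> A \<and> measure M (A - F) < \<eta> / c" if "A \<in> P" for A
    using closed_inner_approximation[OF finite_measure_axioms sets_borel, of A "\<eta> / c"] that P_sets c \<eta>
    by (metis divide_pos_pos less_le_trans subsetD zero_less_one)
  then obtain F where F: "\<And>A. A \<in> P \<Longrightarrow> closed (F A)" "\<And>A. A \<in> P \<Longrightarrow> F A \<subseteq> A"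
    "\<And>A. A \<in> P \<Longrightarrow> measure M (A - F A) < \<eta> / c" by metis
  have FM: "F A \<in> sets M" if "A \<in> P" for A using F(1)[OF that] by (simp add: sets_borel)
  define K where "K = (\<Union>A\<in>P. F A)"
  have KM: "K \<in> sets M" unfolding K_def using finite_P FM by (intro sets.finite_UN) auto
  have "measure M (- K) \<le> measure M (\<Union>A\<in>P. A - F A)"
  proof (rule finite_measure_mono)
    show "- K \<subseteq> (\<Union>A\<in>P. A - F A)"
    proof
      fix x assume "x \<in> - K"
      then show "x \<in> (\<Union>A\<in>P. A - F A)" using cell[of x] by (auto simp: K_def)
    qed
    show "(\<Union>A\<in>P. A - F A) \<in> sets M" using finite_P FM P_sets by (intro sets.finite_UN) auto
  qed
  also have "\<dots> \<le> (\<Sum>A\<in>P. measure M (A - F A))"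
    using finite_P FM P_sets by (intro finite_measure_subadditive_finite) auto
  also have "\<dots> \<le> (\<Sum>A\<in>P. \<eta> / c)" using F(3) by (intro sum_mono less_imp_le)
  also have "\<dots> = \<eta>" using c by (simp add: c_def)
  finally have small: "measure M (- K) \<le> \<eta>" .
  \<comment> \<open>A ball inside \<open>U A\<close> meets no \<open>F B\<close> with B \<noteq> A.
    A Lebesgue number of this open cover is the separation constant, and \<open>g\<close> selects
    \<open>A\<close> for each center.\<close>
  define U where "U A = - (\<Union>B\<in>P - {A}. F B)" for A
  have "UNIV \<subseteq> \<Union> (U ` P)"
  proof
    fix x
    have "x \<in> U (cell x)" using F(2) cell_eq unfolding U_def by blast
    then show "x \<in> \<Union> (U ` P)" using cell(1) by blast
  qed
  moreover have "open G" if "G \<in> U ` P" for G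
    using that F(1) finite_P by (auto simp: U_def intro!: open_Compl closed_UN)
  ultimately obtain \<epsilon> where e: "0 < \<epsilon>" "\<And>x. \<exists>G\<in>U ` P. ball x \<epsilon> \<subseteq> G"
    using Heine_Borel_lemma[OF compact_UNIV, of "U ` P"] by (metis UNIV_I)
  then have "\<forall>x. \<exists>A. A \<in> P \<and> ball x \<epsilon> \<subseteq> U A" by blast
  from choice[OF this] obtain g where g: "\<And>x. g x \<in> P" "\<And>x. ball x \<epsilon> \<subseteq> U (g x)" by blast
  show ?thesis
  proof (rule that[OF KM small e(1)])
    fix z y assume "dist z y < \<epsilon>" "y \<in> K"
    then have "y \<in> U (g z)" using g(2)[of z] by auto
    moreover obtain B where B: "B \<in> P" "y \<in> F B" using \<open>y \<in> K\<close> by (auto simp: K_def)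
    ultimately have "B = g z" by (auto simp: U_def)
    then show "cell y = g z" using B F(2) cell_eq by blast
  qed
qed

text \<open>A cover of a set of full measure is cut off to finitely many balls, which loses at most
  \<eta> of the measure. The bound 1/2 is the share of the code mass not given to single
  letters.\<close>

lemma finite_cover_of_pressure:
  assumes s: "measure_pressure M f (\<lambda>_. 0) < ereal s" and e: "0 < \<epsilon>" and \<eta>: "0 < \<eta>"
  obtains J :: "nat set" and xs ns where "finite J" "\<And>i. i \<in> J \<Longrightarrow> 0 < ns i"
    "(\<Sum>i\<in>J. exp (- s * real (ns i))) \<le> 1 / 2"
    "measure M (- (\<Union>i\<in>J. bowen_ball f (ns i) (xs i) \<epsilon>)) \<le> \<eta>"
proof -
  have "measure_pressure_at M f (\<lambda>_. 0) \<epsilon> \<le> measure_pressure M f (\<lambda>_. 0)"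
    unfolding measure_pressure_eq_SUP using e by (intro SUP_upper) auto
  then have "measure_pressure_at M f (\<lambda>_. 0) \<epsilon> < ereal s" using s by simp
  then obtain Z where Z: "Z \<in> sets M" "measure M Z = 1" "set_pressure f (\<lambda>_. 0) Z \<epsilon> < ereal s"
    unfolding measure_pressure_at_def by (auto simp: INF_less_iff)
  then obtain \<alpha> where \<alpha>: "cover_limit f (\<lambda>_. 0) Z \<alpha> \<epsilon> = 0" "\<alpha> < s"
    unfolding set_pressure_def by (auto simp: Inf_less_iff)
  \<comment> \<open>The minimal length 1 excludes empty blocks.\<close>
  have "cover_sum f (\<lambda>_. 0) Z \<alpha> 1 \<epsilon> < ennreal (1 / 2)"
    using \<alpha>(1) ennreal_zero_less_one ennreal_less_zero_iff[of "1 / 2"] unfolding cover_limit_eq_0_iff by simp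
  then obtain I :: "nat set" and xs ns where I: "Z \<subseteq> (\<Union>i\<in>I. bowen_ball f (ns i) (xs i) \<epsilon>)"
    "\<And>i. i \<in> I \<Longrightarrow> 1 \<le> ns i"
    "(\<Sum>\<^sub>\<infinity>i\<in>I. ennreal (exp (- \<alpha> * real (ns i) + birkhoff_sum f (\<lambda>_. 0) (ns i) (xs i)))) < ennreal (1 / 2)"
    unfolding cover_sum_def Inf_less_iff by blast
  define C where "C k = (\<Union>i\<in>I \<inter> {..k}. bowen_ball f (ns i) (xs i) \<epsilon>)" for k
  have CM: "C k \<in> sets M" for k unfolding C_def by (intro sets.finite_UN) auto
  have "(\<lambda>k. measure M (C k)) \<longlonglongrightarrow> measure M (\<Union>k. C k)"
  proof (rule finite_Lim_measure_incseq)
    show "incseq C" unfolding C_def by (intro incseq_SucI UN_mono) auto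
  qed (use CM in auto)
  moreover have "1 \<le> measure M (\<Union>k. C k)"
    unfolding Z(2)[symmetric] using CM I(1) by (intro finite_measure_mono) (auto simp: C_def, blast)
  ultimately have "eventually (\<lambda>k. 1 - \<eta> < measure M (C k)) sequentially"
    using \<eta> by (intro order_tendstoD(1)) auto
  then obtain k where k: "1 - \<eta> < measure M (C k)" by (meson eventually_happens trivial_limit_sequentially)
  show ?thesis
  proof (rule that[of "I \<inter> {..k}"])
    show "0 < ns i" if "i \<in> I \<inter> {..k}" for i using I(2)[of i] that by auto
    have "ennreal (\<Sum>i\<in>I \<inter> {..k}. exp (- s * real (ns i))) \<le> (\<Sum>i\<in>I \<inter> {..k}. ennreal (exp (- \<alpha> * real (ns i))))"
      using \<alpha>(2) by (subst sum_ennreal[symmetric]) (auto intro!: sum_mono ennreal_leI mult_right_mono)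
    also have "\<dots> \<le> (\<Sum>\<^sub>\<infinity>i\<in>I. ennreal (exp (- \<alpha> * real (ns i) + birkhoff_sum f (\<lambda>_. 0) (ns i) (xs i))))"
      unfolding infsum_ennreal_eq_SUP by (intro SUP_upper2[of "I \<inter> {..k}"]) (auto simp: birkhoff_sum_def)
    also have "\<dots> \<le> ennreal (1 / 2)" using I(3) by simp
    finally show "(\<Sum>i\<in>I \<inter> {..k}. exp (- s * real (ns i))) \<le> 1 / 2" by (subst (asm) ennreal_le_iff) auto
    have "measure M (- C k) = 1 - measure M (C k)"
      using prob_compl[OF CM[of k]] by (simp add: space_UNIV Compl_eq_Diff_UNIV)
    then show "measure M (- (\<Union>i\<in>I \<inter> {..k}. bowen_ball f (ns i) (xs i) \<epsilon>)) \<le> \<eta>"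
      using k by (simp add: C_def)
  qed auto
qed

text \<open>The order of limits matters: with \<theta> fixed the errors are at most
  \<open>D * \<eta>\<close> and vanish with \<eta>. What remains is
  \<open>- ln (1 - \<theta>)\<close>, which the choice of \<theta> makes equal to \<delta>.\<close>

lemma entropy_wrt_partition_le_pressure:
  assumes s: "measure_pressure M f (\<lambda>_. 0) < ereal s"
  shows "entropy_wrt_partition M f P \<le> s"
proof (rule field_le_epsilon)
  fix \<delta> :: real assume \<delta>: "0 < \<delta>"
  define \<theta> where "\<theta> = 1 - exp (- \<delta>)"
  have \<theta>: "0 < \<theta>" "\<theta> < 1" "- ln (1 - \<theta>) = \<delta>" using \<delta> by (auto simp: \<theta>_def)
  define D where "D = ln (card P / \<theta>) + (ln (2 * card P) + \<bar>s + \<delta>\<bar>)"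
  have c: "1 \<le> real (card P)" using finite_P P_nonempty by (simp add: Suc_le_eq card_gt_0_iff)
  have nonneg: "0 \<le> ln (card P / \<theta>)" "0 \<le> ln (2 * card P) + \<bar>s + \<delta>\<bar>"
    using \<theta> c by (auto intro!: ln_ge_zero add_nonneg_nonneg simp: field_simps)
  have le: "entropy_wrt_partition M f P - (s + \<delta>) \<le> D * \<eta>" if \<eta>: "0 < \<eta>" for \<eta>
  proof -
    obtain K \<epsilon> g where K: "K \<in> sets M" "measure M (- K) \<le> \<eta>" "0 < \<epsilon>"
      "\<And>z y. dist z y < \<epsilon> \<Longrightarrow> y \<in> K \<Longrightarrow> cell y = g z"
      by (rule closed_core[OF \<eta>]) (rule that)
    obtain J :: "nat set" and xs ns where J: "finite J" "\<And>i. i \<in> J \<Longrightarrow> 0 < ns i"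
      "(\<Sum>i\<in>J. exp (- s * real (ns i))) \<le> 1 / 2"
      "measure M (- (\<Union>i\<in>J. bowen_ball f (ns i) (xs i) \<epsilon>)) \<le> \<eta>"
      by (rule finite_cover_of_pressure[OF s K(3) \<eta>]) (rule that)
    have "entropy_wrt_partition M f P \<le> s - ln (1 - \<theta>) + ln (card P / \<theta>) * measure M (- K) +
      (ln (2 * card P) + \<bar>s - ln (1 - \<theta>)\<bar>) * measure M (- (\<Union>i\<in>J. bowen_ball f (ns i) (xs i) \<epsilon>))"
      by (rule entropy_le_of_cover[OF J(1-3) K(1,4) \<theta>(1,2)])
    also have "s - ln (1 - \<theta>) = s + \<delta>" using \<theta>(3) by simp
    also have "s + \<delta> + ln (card P / \<theta>) * measure M (- K) +
      (ln (2 * card P) + \<bar>s + \<delta>\<bar>) * measure M (- (\<Union>i\<in>J. bowen_ball f (ns i) (xs i) \<epsilon>)) \<le>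
      s + \<delta> + ln (card P / \<theta>) * \<eta> + (ln (2 * card P) + \<bar>s + \<delta>\<bar>) * \<eta>"
      using nonneg K(2) J(4) by (intro add_mono mult_left_mono order_refl) auto
    finally show ?thesis by (simp add: D_def algebra_simps)
  qed
  have "entropy_wrt_partition M f P - (s + \<delta>) \<le> 0"
  proof (rule tendsto_lowerbound)
    show "((\<lambda>\<eta>. D * \<eta>) \<longlongrightarrow> 0) (at_right 0)" by (auto intro!: tendsto_eq_intros)
    show "\<forall>\<^sub>F \<eta> in at_right 0. entropy_wrt_partition M f P - (s + \<delta>) \<le> D * \<eta>"
      using le by (auto simp: eventually_at_right_field intro: exI[of _ 1])
  qed auto
  then show "entropy_wrt_partition M f P \<le> s + \<delta>" by simp
qed

end

section \<open>Local entropy of ergodic measures\<close>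

context compact_pmp_system
begin

lemma ks_entropy_le_pressure: "ks_entropy M f \<le> measure_pressure M f (\<lambda>_. 0)"
  unfolding ks_entropy_def
proof (rule SUP_least)
  fix P assume P: "P \<in> {P. finite P \<and> P \<subseteq> sets M \<and> partition_on (space M) P}"
  interpret compact_pmp_partition M f P
    by unfold_locales (use P in \<open>auto simp: space_UNIV\<close>)
  show "ereal (entropy_wrt_partition M f P) \<le> measure_pressure M f (\<lambda>_. 0)"
  proof (rule dense_ge)
    fix z assume "measure_pressure M f (\<lambda>_. 0) < z"
    then show "ereal (entropy_wrt_partition M f P) \<le> z"
      using entropy_wrt_partition_le_pressure by (cases z) auto
  qed
qed

lemma pressure_at_0: "pressure_at (\<lambda>_. 0) \<epsilon> x =
    liminf (\<lambda>n. ereal (1 / real n) * minus_ln (measure M (bowen_ball f n x \<epsilon>)))"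
  by (simp add: pressure_at_def birkhoff_sum_def zero_ereal_def[symmetric])

text \<open>The ball of order n + 1 around \<open>x\<close> lies in the preimage of the ball of
  order n around \<open>f x\<close>, which has the same measure as that ball. Dividing by n instead
  of n + 1 costs the factor \<open>1 + 1 / n\<close>, which tends to 1.\<close>

lemma pressure_at_0_image_le: "pressure_at (\<lambda>_. 0) \<epsilon> (f x) \<le> pressure_at (\<lambda>_. 0) \<epsilon> x"
proof -
  define b where "b n = minus_ln (measure M (bowen_ball f n x \<epsilon>))" for n
  have b: "minus_ln (measure M (bowen_ball f n (f x) \<epsilon>)) \<le> b (Suc n)" if n: "0 < n" for n
  proof -
    have "bowen_ball f (Suc n) x \<epsilon> \<subseteq> (f ^^ 1) -` bowen_ball f n (f x) \<epsilon>"
    proof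
      fix y assume y: "y \<in> bowen_ball f (Suc n) x \<epsilon>"
      have "dist ((f ^^ i) (f x)) ((f ^^ i) (f y)) < \<epsilon>" if "i < n" for i
        using y that bowen_ball_iff[of "Suc n" y f x \<epsilon>] by (auto simp: funpow_swap1 dest!: spec[of _ "Suc i"])
      then show "y \<in> (f ^^ 1) -` bowen_ball f n (f x) \<epsilon>" using n by (simp add: bowen_ball_iff)
    qed
    then have "measure M (bowen_ball f (Suc n) x \<epsilon>) \<le> measure M ((f ^^ 1) -` bowen_ball f n (f x) \<epsilon>)"
      by (intro finite_measure_mono vimage_iterate_sets) auto
    then show ?thesis
      unfolding b_def measure_vimage_iterate[OF bowen_ball_sets] by (intro minus_ln_antimono) auto
  qed
  have "pressure_at (\<lambda>_. 0) \<epsilon> (f x) \<le>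
      liminf (\<lambda>n. ereal (1 + 1 / real n) * (ereal (1 / real (Suc n)) * b (Suc n)))"
    unfolding pressure_at_0
  proof (rule Liminf_mono, rule eventually_sequentiallyI[of 1])
    fix n :: nat assume n: "1 \<le> n"
    have eq: "ereal (1 / real n) = ereal (1 + 1 / real n) * ereal (1 / real (Suc n))"
      using n by (simp add: field_simps)
    show "ereal (1 / real n) * minus_ln (measure M (bowen_ball f n (f x) \<epsilon>)) \<le>
      ereal (1 + 1 / real n) * (ereal (1 / real (Suc n)) * b (Suc n))"
      unfolding eq mult.assoc using b[of n] n by (intro ereal_mult_left_mono) auto
  qed
  also have "\<dots> = ereal 1 * liminf (\<lambda>n. ereal (1 / real (Suc n)) * b (Suc n))"
  proof (rule ereal_liminf_lim_mult)
    have "(\<lambda>n. 1 + 1 / real n) \<longlonglongrightarrow> 1 + 0" by (intro tendsto_add tendsto_const lim_const_over_n)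
    then show "(\<lambda>n. ereal (1 + 1 / real n)) \<longlonglongrightarrow> ereal 1" by simp
  qed auto
  also have "\<dots> = liminf (\<lambda>n. ereal (1 / real n) * b n)"
    using liminf_shift[of "\<lambda>n. ereal (1 / real n) * b n"] by simp
  finally show ?thesis by (simp add: pressure_at_0 b_def)
qed

lemma local_entropy_image_le: "local_entropy M f (f x) \<le> local_entropy M f x"
  unfolding local_entropy_eq_pointwise_pressure pointwise_pressure_eq_SUP
  by (intro SUP_mono) (auto intro: pressure_at_0_image_le)

text \<open>Points are classified by the set of all balls containing them, from a finite cover by
  balls of radius \<epsilon> / 2; two points of one class share such a ball.\<close>

lemma small_partition:
  assumes e: "0 < \<epsilon>"
  obtains P where "finite P" "P \<subseteq> sets M" "partition_on UNIV P"
    "\<And>A x y. A \<in> P \<Longrightarrow> x \<in> A \<Longrightarrow> y \<in> A \<Longrightarrow> dist x y < \<epsilon>"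
proof -
  have "\<forall>r>0. \<exists>C :: 'a set. finite C \<and> UNIV \<subseteq> (\<Union>c\<in>C. ball c r)"
    using compact_UNIV compact_eq_totally_bounded by blast
  from this[rule_format, of "\<epsilon> / 2"]
  obtain C :: "'a set" where C: "finite C" "UNIV \<subseteq> (\<Union>c\<in>C. ball c (\<epsilon> / 2))"
    using e by auto
  define h where "h x = {c \<in> C. x \<in> ball c (\<epsilon> / 2)}" for x
  define P where "P = (\<lambda>S. h -` {S}) ` Pow C - {{}}"
  have hM: "h -` {S} \<in> sets M" if "S \<subseteq> C" for S
  proof -
    have "h -` {S} = space M \<inter> ((\<Inter>c\<in>S. ball c (\<epsilon> / 2)) \<inter> (\<Inter>c\<in>C - S. - ball c (\<epsilon> / 2)))"
      using that by (auto simp: h_def space_UNIV)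
    moreover have "(\<Inter>c\<in>S. ball c (\<epsilon> / 2)) \<in> sets borel"
      using finite_subset[OF that C(1)] by (intro borel_open open_INT) auto
    moreover have "(\<Inter>c\<in>C - S. - ball c (\<epsilon> / 2)) \<in> sets borel"
      by (intro borel_closed closed_INT) auto
    ultimately show ?thesis by (simp add: sets_borel space_UNIV)
  qed
  show ?thesis
  proof
    show "finite P" unfolding P_def using C(1) by simp
    show "P \<subseteq> sets M" unfolding P_def using hM by auto
    show "partition_on UNIV P"
    proof (rule partition_onI)
      have "x \<in> \<Union> P" for x
        unfolding P_def by (rule UnionI[of "h -` {h x}"]) (auto simp: h_def)
      then show "\<Union> P = UNIV" by auto
    qed (auto simp: P_def disjnt_def)
    fix A x y assume A: "A \<in> P" "x \<in> A" "y \<in> A"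
    then have eq: "h x = h y" by (auto simp: P_def)
    have "x \<in> (\<Union>c\<in>C. ball c (\<epsilon> / 2))" using C(2) by blast
    then obtain c where "c \<in> h x" by (auto simp: h_def)
    then have "dist c x < \<epsilon> / 2" "dist c y < \<epsilon> / 2" using eq by (auto simp: h_def)
    then show "dist x y < \<epsilon>" by (rule dist_triangle_half_r)
  qed
qed

text \<open>Cylinders of a fine partition lie in Bowen balls, so the normalized information
  functions dominate the terms of \<open>pressure_at\<close>. Fatou's lemma controls only the
  integral of their lower limit; this suffices because ergodicity makes \<open>pressure_at\<close>
  constant at each single radius.\<close>

lemma AE_pressure_at_0_le_ks_entropy:
  assumes erg: "ergodic M f" and e: "0 < \<epsilon>"
  shows "AE x in M. pressure_at (\<lambda>_. 0) \<epsilon> x \<le> ks_entropy M f"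
proof -
  obtain P where P: "finite P" "P \<subseteq> sets M" "partition_on UNIV P"
    "\<And>A x y. A \<in> P \<Longrightarrow> x \<in> A \<Longrightarrow> y \<in> A \<Longrightarrow> dist x y < \<epsilon>"
    by (rule small_partition[OF e]) (rule that)
  interpret pmp_partition M f P by unfold_locales (use P in auto)
  define c where "c = esssup M (pressure_at (\<lambda>_. 0) \<epsilon>)"
  have const: "AE x in M. pressure_at (\<lambda>_. 0) \<epsilon> x = c"
    unfolding c_def by (rule ergodic_AE_const[OF erg]) (auto simp: pressure_at_0_image_le)
  define j where "j n x = 1 / real n * - ln (word_prob (itinerary n x))" for n x
  have j0: "0 \<le> j n x" for n x
    by (cases "word_prob (itinerary n x) = 0") (auto simp: j_def field_simps zero_less_measure_iff ln_le_zero_iff intro!: divide_nonpos_nonneg)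
  have jM[measurable]: "j n \<in> borel_measurable M" for n
    unfolding j_def using itinerary_measurable[of "\<lambda>w. 1 / real n * - ln (word_prob w)"] .
  have ball: "cylinder (itinerary n x) \<subseteq> bowen_ball f n x \<epsilon>" if n: "0 < n" for n x
  proof
    fix y assume "y \<in> cylinder (itinerary n x)"
    then have "itinerary n y = itinerary n x" by (simp add: cylinder_def)
    then have "cell ((f ^^ i) y) = cell ((f ^^ i) x)" if "i < n" for i using that by (metis nth_itinerary)
    then have "dist ((f ^^ i) x) ((f ^^ i) y) < \<epsilon>" if "i < n" for i
      using that P(4)[OF cell(1)] cell(2) by metis
    then show "y \<in> bowen_ball f n x \<epsilon>" using n by (simp add: bowen_ball_iff)
  qed
  have "AE x in M. c \<le> liminf (\<lambda>n. ereal (j n x))"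
    using const AE_word_prob_pos
  proof eventually_elim
    case (elim x)
    have "pressure_at (\<lambda>_. 0) \<epsilon> x \<le> liminf (\<lambda>n. ereal (j n x))"
      unfolding pressure_at_0
    proof (rule Liminf_mono, rule eventually_sequentiallyI[of 1])
      fix n :: nat assume n: "1 \<le> n"
      have "minus_ln (measure M (bowen_ball f n x \<epsilon>)) \<le> minus_ln (word_prob (itinerary n x))"
        using ball[of n x] n by (intro minus_ln_antimono finite_measure_mono) auto
      also have "\<dots> = ereal (- ln (word_prob (itinerary n x)))"
        using elim(2)[rule_format, of n] by (simp add: minus_ln_def)
      finally have "ereal (1 / real n) * minus_ln (measure M (bowen_ball f n x \<epsilon>)) \<le>
          ereal (1 / real n) * ereal (- ln (word_prob (itinerary n x)))"
        by (intro ereal_mult_left_mono) auto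
      then show "ereal (1 / real n) * minus_ln (measure M (bowen_ball f n x \<epsilon>)) \<le> ereal (j n x)"
        by (simp add: j_def)
    qed
    then show ?case using elim(1) by simp
  qed
  note cj = this
  have "c \<le> ereal (entropy_wrt_partition M f P)"
  \<comment> \<open>\<open>c\<close> might be infinite, so it is approached by real numbers from
    below.\<close>
  proof (rule dense_le)
    fix z assume z: "z < c"
    show "z \<le> ereal (entropy_wrt_partition M f P)"
    proof (cases z)
      case (real r)
      have "AE x in M. ennreal r \<le> liminf (\<lambda>n. ennreal (j n x))"
        using cj
      proof eventually_elim
        case (elim x)
        then have "ereal r < liminf (\<lambda>n. ereal (j n x))" using z real by (simp add: less_le_trans)
        then have "eventually (\<lambda>n. ereal r < ereal (j n x)) sequentially" by (rule less_LiminfD)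
        then show ?case
          by (intro Liminf_bounded) (auto elim!: eventually_mono intro!: ennreal_leI)
      qed
      then have "(\<integral>\<^sup>+ x. ennreal r \<partial>M) \<le> (\<integral>\<^sup>+ x. liminf (\<lambda>n. ennreal (j n x)) \<partial>M)"
        by (rule nn_integral_mono_AE)
      also have "\<dots> \<le> liminf (\<lambda>n. \<integral>\<^sup>+ x. ennreal (j n x) \<partial>M)"
        by (rule nn_integral_liminf) measurable
      also have "(\<lambda>n. \<integral>\<^sup>+ x. ennreal (j n x) \<partial>M) = (\<lambda>n. ennreal (join_entropy n / real n))"
      proof
        fix n
        have "integrable M (j n)"
          unfolding j_def using integrable_itinerary[of "\<lambda>w. 1 / real n * - ln (word_prob w)"] .
        then have "(\<integral>\<^sup>+ x. ennreal (j n x) \<partial>M) = ennreal (\<integral>x. j n x \<partial>M)"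
          by (intro nn_integral_eq_integral) (auto simp: j0)
        also have "(\<integral>x. j n x \<partial>M) = 1 / real n * (\<integral>x. - ln (word_prob (itinerary n x)) \<partial>M)"
          unfolding j_def by (rule integral_mult_right_zero)
        finally show "(\<integral>\<^sup>+ x. ennreal (j n x) \<partial>M) = ennreal (join_entropy n / real n)"
          by (simp only: integral_minus_ln_word_prob) simp
      qed
      also have "liminf (\<lambda>n. ennreal (join_entropy n / real n)) = ennreal (entropy_wrt_partition M f P)"
        by (intro lim_imp_Liminf tendsto_ennrealI join_entropy_LIMSEQ) auto
      finally have le: "ennreal r \<le> ennreal (entropy_wrt_partition M f P)"
        by (simp add: emeasure_space_1)
      \<comment> \<open>\<open>ennreal\<close> sends a negative \<open>r\<close> to 0, so in that
        case the bound comes from the sign of the entropy.\<close>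
      have "0 \<le> entropy_wrt_partition M f P"
        by (rule LIMSEQ_le_const[OF join_entropy_LIMSEQ]) (auto simp: join_entropy_nonneg)
      then show ?thesis using le real by (cases "0 \<le> r") (auto simp: ennreal_le_iff)
    qed (use z in auto)
  qed
  also have "\<dots> \<le> ks_entropy M f"
    unfolding ks_entropy_def using P by (intro SUP_upper) (auto simp: space_UNIV)
  finally have le: "c \<le> ks_entropy M f" .
  show ?thesis using const by eventually_elim (simp add: le)
qed

text \<open>The bound of entropy by pressure for the potential 0 reaches only the essential supremum
  of local entropy; almost everywhere constancy makes it a bound at almost every point.\<close>

lemma AE_local_entropy_eq_ks_entropy:
  assumes erg: "ergodic M f"
  shows "AE x in M. local_entropy M f x = ks_entropy M f"
proof -
  have eq: "local_entropy M f = pointwise_pressure M f (\<lambda>_. 0)"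
    by (rule ext) (rule local_entropy_eq_pointwise_pressure)
  have [measurable]: "local_entropy M f \<in> borel_measurable M" unfolding eq by measurable
  have "AE x in M. \<forall>k. pressure_at (\<lambda>_. 0) (1 / real (Suc k)) x \<le> ks_entropy M f"
    unfolding AE_all_countable by (intro allI AE_pressure_at_0_le_ks_entropy[OF erg]) simp
  then have "AE x in M. local_entropy M f x \<le> ks_entropy M f"
    unfolding eq pointwise_pressure_eq_SUP_nat by eventually_elim (auto intro: SUP_least)
  then have "esssup M (local_entropy M f) \<le> ks_entropy M f" by (intro esssup_I) auto
  moreover have "ks_entropy M f \<le> esssup M (local_entropy M f)"
    using ks_entropy_le_pressure measure_pressure_eq_esssup[of "\<lambda>_. 0"] by (simp add: eq)
  moreover have "AE x in M. local_entropy M f x = esssup M (local_entropy M f)"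
    by (rule ergodic_AE_const[OF erg]) (auto simp: local_entropy_image_le)
  ultimately show ?thesis by simp
qed

lemma AE_pointwise_pressure_ergodic:
  assumes erg: "ergodic M f" and cont: "continuous_on UNIV \<phi>"
  shows "AE x in M. pointwise_pressure M f \<phi> x = ks_entropy M f + ereal (\<integral>x. \<phi> x \<partial>M)"
proof -
  obtain C where C: "\<And>x. \<bar>\<phi> x\<bar> \<le> C" using continuous_bounded[OF cont] by blast
  have "AE x in M. birkhoff_average f \<phi> x = (\<integral>x. \<phi> x \<partial>M)"
    by (rule ergodic_birkhoff_average[OF erg continuous_measurable[OF cont] C])
  then show ?thesis
    using AE_pointwise_pressure[OF cont] AE_local_entropy_eq_ks_entropy[OF erg]
    by eventually_elim simp
qed

end

theorem corollary4p1:
  fixes f :: "'a::metric_space \<Rightarrow> 'a" and \<phi> :: "'a \<Rightarrow> real" and \<mu> :: "'a measure"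
  assumes "compact (UNIV :: 'a set)"
    and "continuous_on UNIV f"
    and "continuous_on UNIV \<phi>"
    and "\<mu> \<in> invariant_measures f"
  shows "measure_pressure \<mu> f \<phi> =
           esssup \<mu> (\<lambda>x. local_entropy \<mu> f x + ereal (birkhoff_average f \<phi> x)) \<and>
         (ergodic \<mu> f \<longrightarrow>
           (AE x in \<mu>. pointwise_pressure \<mu> f \<phi> x = measure_pressure \<mu> f \<phi> \<and>
              measure_pressure \<mu> f \<phi> = ks_entropy \<mu> f + ereal (\<integral>x. \<phi> x \<partial>\<mu>)))"
proof -
  have \<mu>: "prob_space \<mu>" "sets \<mu> = sets borel" "\<And>A. A \<in> sets \<mu> \<Longrightarrow> emeasure \<mu> (f -` A) = emeasure \<mu> A"
    using assms(4) by (auto simp: invariant_measures_def)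
  have "f \<in> measurable \<mu> \<mu>"
    using borel_measurable_continuous_onI[OF assms(2)] measurable_cong_sets[OF \<mu>(2,2)] by blast
  then interpret compact_pmp_system \<mu> f
    using \<mu> assms sets_eq_imp_space_eq[OF \<mu>(2)]
    by (intro compact_pmp_system.intro pmp_system.intro pmp_system_axioms.intro compact_pmp_system_axioms.intro) auto
  \<comment> \<open>\<open>esssup\<close> is \<open>top\<close> by default on functions that are not
    measurable, so equality almost everywhere transfers it only together with measurability of both
    functions.\<close>
  have [measurable]: "\<phi> \<in> borel_measurable \<mu>" by (rule continuous_measurable[OF assms(3)])
  have [measurable]: "birkhoff_average f \<phi> \<in> borel_measurable \<mu>"
    unfolding birkhoff_average_def by measurable
  have [measurable]: "local_entropy \<mu> f \<in> borel_measurable \<mu>"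
    unfolding local_entropy_eq_pointwise_pressure[abs_def] by measurable
  have "measure_pressure \<mu> f \<phi> = esssup \<mu> (pointwise_pressure \<mu> f \<phi>)"
    by (rule measure_pressure_eq_esssup[OF assms(3)])
  also have "\<dots> = esssup \<mu> (\<lambda>x. local_entropy \<mu> f x + ereal (birkhoff_average f \<phi> x))"
    using AE_pointwise_pressure[OF assms(3)] by (intro esssup_AE_cong) auto
  finally have 1: "measure_pressure \<mu> f \<phi> = esssup \<mu> (\<lambda>x. local_entropy \<mu> f x + ereal (birkhoff_average f \<phi> x))" .
  have 2: "AE x in \<mu>. pointwise_pressure \<mu> f \<phi> x = measure_pressure \<mu> f \<phi> \<and>
      measure_pressure \<mu> f \<phi> = ks_entropy \<mu> f + ereal (\<integral>x. \<phi> x \<partial>\<mu>)" if erg: "ergodic \<mu> f"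
  proof -
    have const: "AE x in \<mu>. pointwise_pressure \<mu> f \<phi> x = ks_entropy \<mu> f + ereal (\<integral>x. \<phi> x \<partial>\<mu>)"
      by (rule AE_pointwise_pressure_ergodic[OF erg assms(3)])
    have "measure_pressure \<mu> f \<phi> = esssup \<mu> (\<lambda>_. ks_entropy \<mu> f + ereal (\<integral>x. \<phi> x \<partial>\<mu>))"
      unfolding measure_pressure_eq_esssup[OF assms(3)] using const by (intro esssup_AE_cong) auto
    also have "\<dots> = ks_entropy \<mu> f + ereal (\<integral>x. \<phi> x \<partial>\<mu>)" by (rule esssup_const) (simp add: emeasure_space_1)
    finally have eq: "measure_pressure \<mu> f \<phi> = ks_entropy \<mu> f + ereal (\<integral>x. \<phi> x \<partial>\<mu>)" .
    show ?thesis using const by eventually_elim (simp add: eq)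
  qed
  show ?thesis using 1 2 by blast
qed

end
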